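(* Let $L$ be a null hypersurface of a time-orientable Lorentzian manifold $(M,g)$ and $\zeta$ a rigging for $L$, with rigged vector field $\xi$. If $\zeta$ is conformal, then $\nabla_\xi\xi=0$, that is, $\tau(\xi)=0$. Moreover, $\tau(X)=-\tfrac12 g(\widetilde\nabla_\xi\xi,X)$ for all $X\in\mathcal S^\zeta$.
   Context: $(M,g)$ is a time-orientable Lorentzian manifold with Levi-Civita connection $\nabla$. A null hypersurface $i:L\hookrightarrow M$ is a hypersurface on which the induced metric is degenerate. A rigging for $L$ is a vector field $\zeta$ defined on an open set of $M$ containing $L$ with $\zeta_p\notin T_pL$ for all $p\in L$. It is conformal if $L_\zeta g=2\sigma g$ for some function $\sigma$. Put $\alpha=g(\zeta,\cdot)$, $\omega=i^*\alpha$, $\widetilde g=i^*g+\omega\otimes\omega$, which is a Riemannian metric on $L$ (the rigged metric), with Levi-Civita connection $\widetilde\nabla$. The rigged vector field $\xi\in\mathfrak X(L)$ is defined by $\widetilde g(\xi,\cdot)=\omega$; it is the unique null vector field in $L$ with $g(\zeta,\xi)=1$. The screen distribution is $\mathcal S^\zeta=TL\cap\zeta^\perp$. For $U\in\mathfrak X(L)$ one decomposes uniquely $\nabla_U\xi=-\tau(U)\xi-A^*(U)$ with $A^*(U)\in\mathcal S^\zeta$, which defines the one-form $\tau$ on $L$. *)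

theory Defs
  imports "HOL-Analysis.Analysis"
begin

section \<open>Smooth maps between open sets of Euclidean spaces\<close>

text \<open>Only meaningful for open \<open>S\<close>.\<close>

primrec times_diff_on ::
  "nat \<Rightarrow> 'a::euclidean_space set \<Rightarrow> ('a \<Rightarrow> 'b::real_normed_vector) \<Rightarrow> bool"
where
  "times_diff_on 0 S f \<longleftrightarrow> continuous_on S f"
| "times_diff_on (Suc n) S f \<longleftrightarrow>
     (\<forall>x\<in>S. f differentiable (at x)) \<and>
     (\<forall>v. times_diff_on n S (\<lambda>x. frechet_derivative f (at x) v))"

definition smooth_on :: "'a::euclidean_space set \<Rightarrow> ('a \<Rightarrow> 'b::real_normed_vector) \<Rightarrow> bool"
  where "smooth_on S f \<longleftrightarrow> (\<forall>n. times_diff_on n S f)"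

section \<open>Manifolds\<close>

text \<open>
  A chart is a pair of its domain and its coordinate map; values of the map outside the domain are
  irrelevant. A manifold is given by a smooth atlas, and its underlying set is the union of the
  chart domains. The type classes on the points supply the Hausdorff and second countability
  axioms; the dimension of the manifold is that of the model type \<open>'e\<close>.
\<close>

type_synonym ('m, 'e) chart = "'m set \<times> ('m \<Rightarrow> 'e)"

abbreviation chart_inv :: "('m, 'e) chart \<Rightarrow> 'e \<Rightarrow> 'm"
  where "chart_inv c \<equiv> inv_into (fst c) (snd c)"

definition is_chart :: "('m::topological_space, 'e::euclidean_space) chart \<Rightarrow> bool"
  where "is_chart c \<longleftrightarrow> open (fst c) \<and> open (snd c ` fst c) \<and>
    homeomorphism (fst c) (snd c ` fst c) (snd c) (chart_inv c)"

definition carrier_of :: "('m, 'e) chart set \<Rightarrow> 'm set"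
  where "carrier_of A = (\<Union>c\<in>A. fst c)"

definition smooth_atlas ::
  "('m::{t2_space, second_countable_topology}, 'e::euclidean_space) chart set \<Rightarrow> bool"
  where "smooth_atlas A \<longleftrightarrow> (\<forall>c\<in>A. is_chart c) \<and>
    (\<forall>c\<in>A. \<forall>d\<in>A. smooth_on (snd c ` (fst c \<inter> fst d)) (snd d \<circ> chart_inv c))"

definition charts_at :: "('m, 'e) chart set \<Rightarrow> 'm \<Rightarrow> ('m, 'e) chart set"
  where "charts_at A p = {c \<in> A. p \<in> fst c}"

section \<open>Tangent vectors and vector fields\<close>

text \<open>
  A tangent vector at \<open>p\<close> is the family of its coordinate vectors in the charts around \<open>p\<close>, related
  by the derivatives of the transition maps. Families are set to zero at all other arguments, so
  that tangent vectors are equal iff they are equal as functions.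
\<close>

type_synonym ('m, 'e) tvec = "('m, 'e) chart \<Rightarrow> 'e"

definition tangent_space ::
  "('m, 'e::euclidean_space) chart set \<Rightarrow> 'm \<Rightarrow> ('m, 'e) tvec set"
  where "tangent_space A p = {v.
    (\<forall>c\<in>charts_at A p. \<forall>d\<in>charts_at A p.
        v d = frechet_derivative (snd d \<circ> chart_inv c) (at (snd c p)) (v c)) \<and>
    (\<forall>c. c \<notin> charts_at A p \<longrightarrow> v c = 0)}"

text \<open>
  The derivative \<open>v(f)\<close> of a function along \<open>v \<in> T\<^sub>pM\<close>; by the chain rule it does not depend on the
  chart picked.
\<close>

definition dir_deriv ::
  "('m, 'e::euclidean_space) chart set \<Rightarrow> 'm \<Rightarrow> ('m, 'e) tvec \<Rightarrow>
   ('m \<Rightarrow> 'b::real_normed_vector) \<Rightarrow> 'b"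
  where "dir_deriv A p v f =
    (let c = (SOME c. c \<in> charts_at A p)
     in frechet_derivative (f \<circ> chart_inv c) (at (snd c p)) (v c))"

definition smooth_function_on ::
  "('m, 'e::euclidean_space) chart set \<Rightarrow> 'm set \<Rightarrow> ('m \<Rightarrow> real) \<Rightarrow> bool"
  where "smooth_function_on A U f \<longleftrightarrow>
    (\<forall>c\<in>A. smooth_on (snd c ` (fst c \<inter> U)) (f \<circ> chart_inv c))"

definition smooth_vector_field_on ::
  "('m::topological_space, 'e::euclidean_space) chart set \<Rightarrow> 'm set \<Rightarrow> ('m \<Rightarrow> ('m, 'e) tvec) \<Rightarrow> bool"
  where "smooth_vector_field_on A U X \<longleftrightarrow>
    open U \<and> U \<subseteq> carrier_of A \<and>
    (\<forall>p\<in>U. X p \<in> tangent_space A p) \<and>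
    (\<forall>c\<in>A. smooth_on (snd c ` (fst c \<inter> U)) (\<lambda>x. X (chart_inv c x) c))"

definition lie_bracket ::
  "('m, 'e::euclidean_space) chart set \<Rightarrow> ('m \<Rightarrow> ('m, 'e) tvec) \<Rightarrow> ('m \<Rightarrow> ('m, 'e) tvec) \<Rightarrow>
   'm \<Rightarrow> ('m, 'e) tvec"
  where "lie_bracket A X Y p = (\<lambda>c. if c \<in> charts_at A p
    then dir_deriv A p (X p) (\<lambda>q. Y q c) - dir_deriv A p (Y p) (\<lambda>q. X q c) else 0)"

section \<open>Metrics\<close>

type_synonym ('m, 'e) metric = "'m \<Rightarrow> ('m, 'e) tvec \<Rightarrow> ('m, 'e) tvec \<Rightarrow> real"

definition smooth_sym_tensor ::
  "('m::topological_space, 'e::euclidean_space) chart set \<Rightarrow> ('m, 'e) metric \<Rightarrow> bool"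
  where "smooth_sym_tensor A g \<longleftrightarrow>
    (\<forall>p\<in>carrier_of A. \<forall>u\<in>tangent_space A p. \<forall>v\<in>tangent_space A p.
       g p u v = g p v u \<and>
       (\<forall>w\<in>tangent_space A p. \<forall>a.
          g p (\<lambda>c. a *\<^sub>R u c + v c) w = a * g p u w + g p v w)) \<and>
    (\<forall>U X Y. smooth_vector_field_on A U X \<longrightarrow> smooth_vector_field_on A U Y \<longrightarrow>
       smooth_function_on A U (\<lambda>p. g p (X p) (Y p)))"

text \<open>
  Signature \<open>(-,+,\<dots>,+)\<close>: every tangent space has an orthonormal basis with exactly one timelike
  member. The basis is indexed by \<open>Basis\<close>, which has as many elements as the dimension, and its
  linear independence is implied by the orthogonality relations.
\<close>

definition lorentzian_metric ::
  "('m::topological_space, 'e::euclidean_space) chart set \<Rightarrow> ('m, 'e) metric \<Rightarrow> bool"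
  where "lorentzian_metric A g \<longleftrightarrow> smooth_sym_tensor A g \<and>
    (\<forall>p\<in>carrier_of A. \<exists>E :: 'e \<Rightarrow> ('m, 'e) tvec. \<exists>b\<^sub>0\<in>Basis.
       (\<forall>b\<in>Basis. E b \<in> tangent_space A p) \<and>
       (\<forall>b\<in>Basis. \<forall>b'\<in>Basis.
          g p (E b) (E b') = (if b \<noteq> b' then 0 else if b = b\<^sub>0 then - 1 else 1)))"

definition time_orientable ::
  "('m::topological_space, 'e::euclidean_space) chart set \<Rightarrow> ('m, 'e) metric \<Rightarrow> bool"
  where "time_orientable A g \<longleftrightarrow>
    (\<exists>T. smooth_vector_field_on A (carrier_of A) T \<and> (\<forall>p\<in>carrier_of A. g p (T p) (T p) < 0))"

definition lie_deriv_metric ::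
  "('m, 'e::euclidean_space) chart set \<Rightarrow> ('m, 'e) metric \<Rightarrow> ('m \<Rightarrow> ('m, 'e) tvec) \<Rightarrow>
   ('m \<Rightarrow> ('m, 'e) tvec) \<Rightarrow> ('m \<Rightarrow> ('m, 'e) tvec) \<Rightarrow> 'm \<Rightarrow> real"
  where "lie_deriv_metric A g Z X Y p =
    dir_deriv A p (Z p) (\<lambda>q. g q (X q) (Y q))
    - g p (lie_bracket A Z X p) (Y p) - g p (X p) (lie_bracket A Z Y p)"

definition conformal_field_on ::
  "('m::topological_space, 'e::euclidean_space) chart set \<Rightarrow> ('m, 'e) metric \<Rightarrow> 'm set \<Rightarrow>
   ('m \<Rightarrow> ('m, 'e) tvec) \<Rightarrow> bool"
  where "conformal_field_on A g U Z \<longleftrightarrow>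
    (\<exists>\<sigma> :: 'm \<Rightarrow> real. \<forall>V X Y. V \<subseteq> U \<longrightarrow>
       smooth_vector_field_on A V X \<longrightarrow> smooth_vector_field_on A V Y \<longrightarrow>
       (\<forall>p\<in>V. lie_deriv_metric A g Z X Y p = 2 * \<sigma> p * g p (X p) (Y p)))"

section \<open>Connections\<close>

text \<open>
  An affine connection is encoded by its Christoffel maps: in the chart \<open>c\<close>, the covariant
  derivative \<open>\<nabla>\<^sub>X Y\<close> has the coordinates \<open>X(Y\<^sup>k) + \<Gamma>\<^sup>k\<^sub>i\<^sub>j X\<^sup>i Y\<^sup>j\<close>.
  That \<open>\<nabla>\<^sub>X Y\<close> is again a vector field is the transformation law of the Christoffel symbols; the
  Leibniz rule and linearity over functions are built into the formula. Fields on arbitrary open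
  subsets are admitted, so that no extension to globally defined fields is involved.
\<close>

type_synonym ('m, 'e) christoffel = "('m, 'e) chart \<Rightarrow> 'm \<Rightarrow> 'e \<Rightarrow> 'e \<Rightarrow> 'e"

definition cov_deriv ::
  "('m, 'e::euclidean_space) chart set \<Rightarrow> ('m, 'e) christoffel \<Rightarrow>
   ('m \<Rightarrow> ('m, 'e) tvec) \<Rightarrow> ('m \<Rightarrow> ('m, 'e) tvec) \<Rightarrow> 'm \<Rightarrow> ('m, 'e) tvec"
  where "cov_deriv A \<Gamma> X Y p = (\<lambda>c. if c \<in> charts_at A p
    then dir_deriv A p (X p) (\<lambda>q. Y q c) + \<Gamma> c p (X p c) (Y p c) else 0)"

definition affine_connection ::
  "('m::topological_space, 'e::euclidean_space) chart set \<Rightarrow> ('m, 'e) christoffel \<Rightarrow> bool"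
  where "affine_connection A \<Gamma> \<longleftrightarrow>
    (\<forall>c\<in>A. \<forall>p\<in>fst c. bilinear (\<Gamma> c p)) \<and>
    (\<forall>U X Y. smooth_vector_field_on A U X \<longrightarrow> smooth_vector_field_on A U Y \<longrightarrow>
       smooth_vector_field_on A U (cov_deriv A \<Gamma> X Y))"

definition levi_civita ::
  "('m::topological_space, 'e::euclidean_space) chart set \<Rightarrow> ('m, 'e) metric \<Rightarrow>
   ('m, 'e) christoffel \<Rightarrow> bool"
  where "levi_civita A g \<Gamma> \<longleftrightarrow> affine_connection A \<Gamma> \<and>
    (\<forall>U X Y. smooth_vector_field_on A U X \<longrightarrow> smooth_vector_field_on A U Y \<longrightarrow>
       (\<forall>p\<in>U. (\<lambda>c. cov_deriv A \<Gamma> X Y p c - cov_deriv A \<Gamma> Y X p c) = lie_bracket A X Y p)) \<and>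
    (\<forall>U X Y Z. smooth_vector_field_on A U X \<longrightarrow> smooth_vector_field_on A U Y \<longrightarrow>
       smooth_vector_field_on A U Z \<longrightarrow>
       (\<forall>p\<in>U. dir_deriv A p (X p) (\<lambda>q. g q (Y q) (Z q)) =
          g p (cov_deriv A \<Gamma> X Y p) (Z p) + g p (Y p) (cov_deriv A \<Gamma> X Z p)))"

section \<open>Hypersurfaces\<close>

definition smooth_map ::
  "('n::topological_space, 'l::euclidean_space) chart set \<Rightarrow>
   ('m::topological_space, 'e::euclidean_space) chart set \<Rightarrow> ('n \<Rightarrow> 'm) \<Rightarrow> bool"
  where "smooth_map B A i \<longleftrightarrow>
    i ` carrier_of B \<subseteq> carrier_of A \<and> continuous_on (carrier_of B) i \<and>
    (\<forall>c\<in>B. \<forall>d\<in>A. smooth_on (snd c ` (fst c \<inter> i -` fst d)) (snd d \<circ> i \<circ> chart_inv c))"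

definition differential ::
  "('n, 'l::euclidean_space) chart set \<Rightarrow> ('m, 'e::euclidean_space) chart set \<Rightarrow> ('n \<Rightarrow> 'm) \<Rightarrow>
   'n \<Rightarrow> ('n, 'l) tvec \<Rightarrow> ('m, 'e) tvec"
  where "differential B A i p v =
    (\<lambda>d. if d \<in> charts_at A (i p) then dir_deriv B p v (snd d \<circ> i) else 0)"

text \<open>
  A hypersurface is an injective immersion of codimension one. Embedded hypersurfaces are those
  for which the topology of the source is induced by \<open>i\<close>; this is not required.
\<close>

definition hypersurface ::
  "('n::{t2_space, second_countable_topology}, 'l::euclidean_space) chart set \<Rightarrow>
   ('m::{t2_space, second_countable_topology}, 'e::euclidean_space) chart set \<Rightarrow>
   ('n \<Rightarrow> 'm) \<Rightarrow> bool"
  where "hypersurface B A i \<longleftrightarrow>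
    smooth_atlas B \<and> smooth_map B A i \<and> inj_on i (carrier_of B) \<and>
    (\<forall>p\<in>carrier_of B. inj_on (differential B A i p) (tangent_space B p)) \<and>
    DIM('l) + 1 = DIM('e)"

definition pullback_metric ::
  "('n, 'l::euclidean_space) chart set \<Rightarrow> ('m, 'e::euclidean_space) chart set \<Rightarrow> ('n \<Rightarrow> 'm) \<Rightarrow>
   ('m, 'e) metric \<Rightarrow> ('n, 'l) metric"
  where "pullback_metric B A i g p u v =
    g (i p) (differential B A i p u) (differential B A i p v)"

definition null_hypersurface ::
  "('n::{t2_space, second_countable_topology}, 'l::euclidean_space) chart set \<Rightarrow>
   ('m::{t2_space, second_countable_topology}, 'e::euclidean_space) chart set \<Rightarrow>
   ('n \<Rightarrow> 'm) \<Rightarrow> ('m, 'e) metric \<Rightarrow> bool"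
  where "null_hypersurface B A i g \<longleftrightarrow> hypersurface B A i \<and>
    (\<forall>p\<in>carrier_of B. \<exists>u\<in>tangent_space B p. u \<noteq> (\<lambda>_. 0) \<and>
       (\<forall>v\<in>tangent_space B p. pullback_metric B A i g p u v = 0))"

text \<open>
  The covariant derivative at \<open>p\<close> in the direction \<open>u \<in> T\<^sub>pL\<close> of a vector field \<open>V\<close> along \<open>i\<close>, that
  is, with respect to the pullback of the ambient connection. If \<open>V\<close> is locally the restriction
  of a vector field \<open>Y\<close> of the ambient manifold, the chain rule gives \<open>\<nabla>\<^sub>u Y\<close>.
\<close>

definition cov_deriv_along ::
  "('n, 'l::euclidean_space) chart set \<Rightarrow> ('m, 'e::euclidean_space) chart set \<Rightarrow> ('n \<Rightarrow> 'm) \<Rightarrow>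
   ('m, 'e) christoffel \<Rightarrow> 'n \<Rightarrow> ('n, 'l) tvec \<Rightarrow> ('n \<Rightarrow> ('m, 'e) tvec) \<Rightarrow> ('m, 'e) tvec"
  where "cov_deriv_along B A i \<Gamma> p u V = (\<lambda>d. if d \<in> charts_at A (i p)
    then dir_deriv B p u (\<lambda>q. V q d) + \<Gamma> d (i p) (differential B A i p u d) (V p d) else 0)"

section \<open>Riggings\<close>

definition rigging ::
  "('n, 'l::euclidean_space) chart set \<Rightarrow>
   ('m::topological_space, 'e::euclidean_space) chart set \<Rightarrow> ('n \<Rightarrow> 'm) \<Rightarrow>
   'm set \<Rightarrow> ('m \<Rightarrow> ('m, 'e) tvec) \<Rightarrow> bool"
  where "rigging B A i U \<zeta> \<longleftrightarrow>
    smooth_vector_field_on A U \<zeta> \<and> i ` carrier_of B \<subseteq> U \<and>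
    (\<forall>p\<in>carrier_of B. \<zeta> (i p) \<notin> differential B A i p ` tangent_space B p)"

text \<open>The one-form \<open>\<omega> = i\<^sup>*\<alpha>\<close> with \<open>\<alpha> = g(\<zeta>,\<cdot>)\<close>.\<close>

definition rigging_form ::
  "('n, 'l::euclidean_space) chart set \<Rightarrow> ('m, 'e::euclidean_space) chart set \<Rightarrow> ('n \<Rightarrow> 'm) \<Rightarrow>
   ('m, 'e) metric \<Rightarrow> ('m \<Rightarrow> ('m, 'e) tvec) \<Rightarrow> 'n \<Rightarrow> ('n, 'l) tvec \<Rightarrow> real"
  where "rigging_form B A i g \<zeta> p v = g (i p) (\<zeta> (i p)) (differential B A i p v)"

definition rigged_metric ::
  "('n, 'l::euclidean_space) chart set \<Rightarrow> ('m, 'e::euclidean_space) chart set \<Rightarrow> ('n \<Rightarrow> 'm) \<Rightarrow>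
   ('m, 'e) metric \<Rightarrow> ('m \<Rightarrow> ('m, 'e) tvec) \<Rightarrow> ('n, 'l) metric"
  where "rigged_metric B A i g \<zeta> p u v =
    pullback_metric B A i g p u v + rigging_form B A i g \<zeta> p u * rigging_form B A i g \<zeta> p v"

definition rigged_vector_field ::
  "('n::topological_space, 'l::euclidean_space) chart set \<Rightarrow>
   ('m, 'e::euclidean_space) chart set \<Rightarrow> ('n \<Rightarrow> 'm) \<Rightarrow>
   ('m, 'e) metric \<Rightarrow> ('m \<Rightarrow> ('m, 'e) tvec) \<Rightarrow> ('n \<Rightarrow> ('n, 'l) tvec) \<Rightarrow> bool"
  where "rigged_vector_field B A i g \<zeta> \<xi> \<longleftrightarrow>
    smooth_vector_field_on B (carrier_of B) \<xi> \<and>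
    (\<forall>p\<in>carrier_of B. \<forall>v\<in>tangent_space B p.
       rigged_metric B A i g \<zeta> p (\<xi> p) v = rigging_form B A i g \<zeta> p v)"

definition screen ::
  "('n, 'l::euclidean_space) chart set \<Rightarrow> ('m, 'e::euclidean_space) chart set \<Rightarrow> ('n \<Rightarrow> 'm) \<Rightarrow>
   ('m, 'e) metric \<Rightarrow> ('m \<Rightarrow> ('m, 'e) tvec) \<Rightarrow> 'n \<Rightarrow> ('n, 'l) tvec set"
  where "screen B A i g \<zeta> p =
    {v \<in> tangent_space B p. g (i p) (\<zeta> (i p)) (differential B A i p v) = 0}"

text \<open>\<open>\<nabla>\<^sub>u \<xi>\<close> for \<open>u \<in> T\<^sub>pL\<close>, with the ambient connection.\<close>

definition ambient_deriv ::
  "('n, 'l::euclidean_space) chart set \<Rightarrow> ('m, 'e::euclidean_space) chart set \<Rightarrow> ('n \<Rightarrow> 'm) \<Rightarrow>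
   ('m, 'e) christoffel \<Rightarrow> ('n \<Rightarrow> ('n, 'l) tvec) \<Rightarrow> 'n \<Rightarrow> ('n, 'l) tvec \<Rightarrow> ('m, 'e) tvec"
  where "ambient_deriv B A i \<Gamma> \<xi> p u =
    cov_deriv_along B A i \<Gamma> p u (\<lambda>q. differential B A i q (\<xi> q))"

text \<open>\<open>\<tau>(u)\<close> is determined by \<open>\<nabla>\<^sub>u \<xi> = - \<tau>(u) \<xi> - A\<^sup>*(u)\<close> with \<open>A\<^sup>*(u)\<close> in the screen.\<close>

definition rotation_form ::
  "('n, 'l::euclidean_space) chart set \<Rightarrow> ('m, 'e::euclidean_space) chart set \<Rightarrow> ('n \<Rightarrow> 'm) \<Rightarrow>
   ('m, 'e) metric \<Rightarrow> ('m, 'e) christoffel \<Rightarrow> ('m \<Rightarrow> ('m, 'e) tvec) \<Rightarrow>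
   ('n \<Rightarrow> ('n, 'l) tvec) \<Rightarrow> 'n \<Rightarrow> ('n, 'l) tvec \<Rightarrow> real"
  where "rotation_form B A i g \<Gamma> \<zeta> \<xi> p u =
    (THE t. \<exists>a\<in>screen B A i g \<zeta> p. ambient_deriv B A i \<Gamma> \<xi> p u =
       (\<lambda>d. - t *\<^sub>R differential B A i p (\<xi> p) d - differential B A i p a d))"

end

theory Submission
  imports Defs
begin

text \<open>
  Let \<open>\<omega> = i\<^sup>*g(\<zeta>,\<cdot>)\<close>. Pairing \<open>\<xi>\<close> with the radical of \<open>i\<^sup>*g\<close> gives \<open>\<omega>(\<xi>) = 1\<close> and hence
  \<open>g(\<xi>,v) = 0\<close> for all \<open>v\<close> tangent to \<open>L\<close>; consequently \<open>\<tau>(u) = - g(\<zeta>,\<nabla>\<^sub>u\<xi>) = g(\<nabla>\<^sub>u\<zeta>,\<xi>)\<close>.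
  For \<open>X\<close> tangent to \<open>L\<close> we have \<open>g(\<nabla>\<^sub>\<xi>\<xi>,X) = - g(\<xi>,\<nabla>\<^sub>X\<xi> + [\<xi>,X]) = 0\<close>, and conformality gives
  \<open>g(\<nabla>\<^sub>\<xi>\<xi>,\<zeta>) = - g(\<xi>,\<nabla>\<^sub>\<xi>\<zeta>) = - \<sigma> g(\<xi>,\<xi>) = 0\<close>, so \<open>\<nabla>\<^sub>\<xi>\<xi> = 0\<close> by nondegeneracy.
  As \<open>\<xi>\<close> is a unit field for the rigged metric with dual form \<open>\<omega>\<close>, the rigged product of its
  intrinsic acceleration with \<open>X\<close> is \<open>d\<omega>(\<xi>,X) = g(\<nabla>\<^sub>\<xi>\<zeta>,X) - g(\<nabla>\<^sub>X\<zeta>,\<xi>)\<close>, and conformality turns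
  this into \<open>- 2 g(\<nabla>\<^sub>X\<zeta>,\<xi>) = - 2 \<tau>(X)\<close>.
\<close>

section \<open>Calculus of smooth maps\<close>

text \<open>The obstacle is that \<xi> lives on L only, whereas torsion-freeness and metric
  compatibility of \<nabla> are given for fields on open sets of M, and L may be merely immersed. No
  extension of \<xi> is constructed. Both laws are instead tested on fields with constant
  coordinates in a chart, which turns them into pointwise formulas: the Christoffel maps are
  symmetric, and they determine the first derivatives of the metric coefficients. Composed with
  \<open>i\<close>, these formulas make the pulled back connection metric and torsion free; the
  latter also rests on the symmetry of the second derivatives of \<open>i\<close>. The two
  connections meet in a single function: for the rigged metric h one has h(\<xi>,X) = g(\<zeta>,X)
  on L. Its derivative along \<xi> is computed once with each connection, and the bracket [\<xi>,X]
  drops out on comparison.\<close>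

lemma times_diff_on_subset:
  "times_diff_on n S f \<Longrightarrow> T \<subseteq> S \<Longrightarrow> times_diff_on n T f"
  by (induction n arbitrary: f) (auto intro: continuous_on_subset)

lemma frechet_derivative_eqI: "(f has_derivative f') (at x) \<Longrightarrow> frechet_derivative f (at x) = f'"
  by (rule frechet_derivative_at[symmetric])

text \<open>A derivative at a point of the open set \<open>S\<close> only sees nearby values, so
  agreement on \<open>S\<close> passes to all derivatives, as the induction requires.\<close>

lemma times_diff_on_cong:
  assumes "open S" "\<And>x. x \<in> S \<Longrightarrow> f x = g x" "times_diff_on n S f"
  shows "times_diff_on n S g"
  using assms(2,3)
proof (induction n arbitrary: f g)
  case 0
  then show ?case by (auto cong: continuous_on_cong)
next
  case (Suc n)
  have d: "f differentiable (at x)" if "x \<in> S" for x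
    using Suc.prems that by auto
  have d': "(g has_derivative frechet_derivative f (at x)) (at x)" if "x \<in> S" for x
    using has_derivative_transform_within_open[OF _ assms(1) that, of f "frechet_derivative f (at x)" UNIV g]
      d[OF that] Suc.prems(1) frechet_derivative_works by blast
  have "times_diff_on n S (\<lambda>x. frechet_derivative g (at x) v)" for v
    by (rule Suc.IH[of "\<lambda>x. frechet_derivative f (at x) v"])
      (use Suc.prems frechet_derivative_eqI[OF d'] in auto)
  then show ?case using d' by (auto simp: differentiable_def)
qed

lemma times_diff_on_SucD: "times_diff_on (Suc n) S f \<Longrightarrow> times_diff_on n S f"
proof (induction n arbitrary: f)
  case 0
  then show ?case
    by (auto intro!: continuous_at_imp_continuous_on differentiable_imp_continuous_within)
next
  case (Suc n)
  then show ?case by (subst times_diff_on.simps) auto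
qed

text \<open>The common induction step of the closure rules: any explicit formula for the derivative
  may be used instead of \<open>frechet_derivative\<close>.\<close>

lemma times_diff_on_SucI:
  assumes "open S" "\<And>x. x \<in> S \<Longrightarrow> (f has_derivative f' x) (at x)"
    "\<And>v. times_diff_on n S (\<lambda>x. f' x v)"
  shows "times_diff_on (Suc n) S f"
  using assms frechet_derivative_eqI[OF assms(2)]
  by (auto simp: differentiable_def intro: times_diff_on_cong[where f = "\<lambda>x. f' x v" for v])

lemma times_diff_on_has_derivative:
  "times_diff_on (Suc n) S f \<Longrightarrow> x \<in> S \<Longrightarrow> (f has_derivative frechet_derivative f (at x)) (at x)"
  by (simp add: frechet_derivative_works)

lemma times_diff_on_deriv:
  "times_diff_on (Suc n) S f \<Longrightarrow> times_diff_on n S (\<lambda>x. frechet_derivative f (at x) v)"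
  by simp

lemma times_diff_on_const: "open S \<Longrightarrow> times_diff_on n S (\<lambda>_. c)"
  by (induction n arbitrary: c) simp_all

lemma times_diff_on_add:
  "open S \<Longrightarrow> times_diff_on n S f \<Longrightarrow> times_diff_on n S g \<Longrightarrow> times_diff_on n S (\<lambda>x. f x + g x)"
proof (induction n arbitrary: f g)
  case 0
  then show ?case by (auto intro: continuous_on_add)
next
  case (Suc n)
  show ?case
    by (rule times_diff_on_SucI[OF \<open>open S\<close> has_derivative_add
          [OF Suc.prems(2,3)[THEN times_diff_on_has_derivative]]])
      (use Suc in auto)
qed

lemma times_diff_on_sum:
  "open S \<Longrightarrow> finite I \<Longrightarrow> (\<And>i. i \<in> I \<Longrightarrow> times_diff_on n S (f i)) \<Longrightarrow>
    times_diff_on n S (\<lambda>x. \<Sum>i\<in>I. f i x)"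
  by (induction I rule: infinite_finite_induct)
    (auto intro: times_diff_on_const times_diff_on_add)

lemma times_diff_on_scaleR:
  "open S \<Longrightarrow> times_diff_on n S f \<Longrightarrow> times_diff_on n S g \<Longrightarrow> times_diff_on n S (\<lambda>x. f x *\<^sub>R g x)"
proof (induction n arbitrary: f g)
  case 0
  then show ?case by (auto intro: continuous_on_scaleR)
next
  case (Suc n)
  show ?case
    by (rule times_diff_on_SucI[OF \<open>open S\<close> has_derivative_scaleR
          [OF Suc.prems(2,3)[THEN times_diff_on_has_derivative]]],
        assumption, assumption)
      (intro times_diff_on_add Suc.IH times_diff_on_deriv Suc.prems Suc.prems(2,3)[THEN times_diff_on_SucD])
qed

lemma times_diff_on_inner:
  fixes f :: "'a::euclidean_space \<Rightarrow> 'b::euclidean_space"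
  shows "open S \<Longrightarrow> times_diff_on n S f \<Longrightarrow> times_diff_on n S (\<lambda>x. f x \<bullet> b)"
proof (induction n arbitrary: f)
  case 0
  then show ?case by (auto intro: continuous_on_inner)
next
  case (Suc n)
  show ?case
    by (rule times_diff_on_SucI[OF \<open>open S\<close> has_derivative_inner_left
          [OF Suc.prems(2)[THEN times_diff_on_has_derivative]]])
      (use Suc in auto)
qed

text \<open>Serves to differentiate a linear map at a moving argument: the expansion separates the
  moving coefficients from the values on fixed vectors.\<close>

lemma linear_Basis_expansion:
  fixes f :: "'a::euclidean_space \<Rightarrow> 'b::real_vector"
  assumes "linear f"
  shows "f v = (\<Sum>b\<in>Basis. (v \<bullet> b) *\<^sub>R f b)"
  by (subst euclidean_representation[of v, symmetric])
     (simp only: linear_sum[OF assms] linear_scale[OF assms])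

text \<open>In the chain rule the derivative of \<open>f\<close> is applied to a vector that varies
  with the point. Expanding that vector over \<open>Basis\<close> leaves scalars built from
  \<open>g\<close> and the partial derivatives of \<open>f\<close> composed with \<open>g\<close>,
  to which the induction hypothesis applies.\<close>

lemma times_diff_on_compose:
  fixes g :: "'a::euclidean_space \<Rightarrow> 'b::euclidean_space" and f :: "'b \<Rightarrow> 'c::real_normed_vector"
  assumes "open S" "open T" "g ` S \<subseteq> T" "times_diff_on n S g" "times_diff_on n T f"
  shows "times_diff_on n S (f \<circ> g)"
  using assms(4,5)
proof (induction n arbitrary: f)
  case 0
  then show ?case using assms(3)
    by (auto intro: continuous_on_compose continuous_on_subset simp del: o_apply)
next
  case (Suc n)
  note g = times_diff_on_has_derivative[OF Suc.prems(1)]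
  note f = times_diff_on_has_derivative[OF Suc.prems(2)]
  have lin: "linear (frechet_derivative f (at (g x)))" if "x \<in> S" for x
    using f[of "g x"] that assms(3) has_derivative_linear by blast
  have d: "((f \<circ> g) has_derivative (\<lambda>v. \<Sum>b\<in>Basis. (frechet_derivative g (at x) v \<bullet> b) *\<^sub>R
      ((\<lambda>z. frechet_derivative f (at z) b) \<circ> g) x)) (at x)" if "x \<in> S" for x
    using diff_chain_at[OF g[OF that] f[of "g x"]] that assms(3)
    by (simp add: linear_Basis_expansion[OF lin[OF that], symmetric] image_subset_iff o_def)
  show ?case
    by (rule times_diff_on_SucI[OF \<open>open S\<close> d], assumption)
      (intro times_diff_on_sum times_diff_on_scaleR times_diff_on_inner times_diff_on_deriv
        Suc.IH Suc.prems times_diff_on_SucD[OF Suc.prems(1)] assms finite_Basis)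
qed

lemma smooth_on_compose:
  "open S \<Longrightarrow> open T \<Longrightarrow> g ` S \<subseteq> T \<Longrightarrow> smooth_on S g \<Longrightarrow> smooth_on T f \<Longrightarrow> smooth_on S (f \<circ> g)"
  unfolding smooth_on_def using times_diff_on_compose by blast

lemma smooth_on_subset: "smooth_on S f \<Longrightarrow> T \<subseteq> S \<Longrightarrow> smooth_on T f"
  unfolding smooth_on_def using times_diff_on_subset by blast

lemma smooth_on_cong: "open S \<Longrightarrow> (\<And>x. x \<in> S \<Longrightarrow> f x = g x) \<Longrightarrow> smooth_on S f \<Longrightarrow> smooth_on S g"
  unfolding smooth_on_def using times_diff_on_cong by blast

lemma smooth_on_deriv: "smooth_on S f \<Longrightarrow> smooth_on S (\<lambda>x. frechet_derivative f (at x) v)"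
  unfolding smooth_on_def using times_diff_on_deriv by blast

lemma smooth_on_has_derivative:
  "smooth_on S f \<Longrightarrow> x \<in> S \<Longrightarrow> (f has_derivative frechet_derivative f (at x)) (at x)"
  unfolding smooth_on_def using times_diff_on_has_derivative by blast

lemma smooth_on_continuous_on: "smooth_on S f \<Longrightarrow> continuous_on S f"
  unfolding smooth_on_def by (metis times_diff_on.simps(1))

lemma smooth_on_inner:
  fixes f :: "'a::euclidean_space \<Rightarrow> 'b::euclidean_space"
  shows "open S \<Longrightarrow> smooth_on S f \<Longrightarrow> smooth_on S (\<lambda>x. f x \<bullet> b)"
  unfolding smooth_on_def using times_diff_on_inner by blast

section \<open>Symmetry of second derivatives\<close>

lemma second_difference_MVT:
  fixes f :: "'a::euclidean_space \<Rightarrow> real"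
  assumes f: "smooth_on S f" and h: "0 < h"
    and S: "\<And>s t. \<bar>s\<bar> \<le> h \<Longrightarrow> \<bar>t\<bar> \<le> h \<Longrightarrow> x + s *\<^sub>R u + t *\<^sub>R v \<in> S"
  obtains s t where "\<bar>s\<bar> \<le> h" "\<bar>t\<bar> \<le> h"
    "f (x + h *\<^sub>R u + h *\<^sub>R v) - f (x + h *\<^sub>R u) - f (x + h *\<^sub>R v) + f x =
      h * h * frechet_derivative (\<lambda>y. frechet_derivative f (at y) u)
        (at (x + s *\<^sub>R u + t *\<^sub>R v)) v"
proof -
  define D where "D y = frechet_derivative f (at y)" for y
  have lin: "linear (D y)" if "y \<in> S" for y
    using smooth_on_has_derivative[OF f that] has_derivative_linear by (simp add: D_def)
  have d: "((\<lambda>s. f (x + s *\<^sub>R u + t *\<^sub>R v)) has_real_derivative D (x + s *\<^sub>R u + t *\<^sub>R v) u) (at s)"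
    if "\<bar>s\<bar> \<le> h" "\<bar>t\<bar> \<le> h" for s t
  proof -
    have "((\<lambda>s. x + s *\<^sub>R u + t *\<^sub>R v) has_derivative (\<lambda>k. k *\<^sub>R u)) (at s)"
      by (auto intro!: derivative_eq_intros)
    from diff_chain_at[OF this smooth_on_has_derivative[OF f S[OF that]]] show ?thesis
      by (simp add: o_def D_def[symmetric] linear_scale[OF lin[OF S[OF that]]]
          has_field_derivative_def mult.commute[of _ "D _ _"])
  qed
  \<comment> \<open>The second difference is the increment over [0,h] of s \<mapsto> f(x + s u + h
    v) - f(x + s u); a second mean value step in direction \<open>v\<close> follows. The multiples
    by 0 keep every term an instance of \<open>d\<close>.\<close>
  have "\<exists>s>0. s < h \<and> (f (x + h *\<^sub>R u + h *\<^sub>R v) - f (x + h *\<^sub>R u + 0 *\<^sub>R v)) -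
      (f (x + 0 *\<^sub>R u + h *\<^sub>R v) - f (x + 0 *\<^sub>R u + 0 *\<^sub>R v)) =
      (h - 0) * (D (x + s *\<^sub>R u + h *\<^sub>R v) u - D (x + s *\<^sub>R u + 0 *\<^sub>R v) u)"
    by (rule MVT2[OF h], rule DERIV_diff[OF d[of _ h] d[of _ 0]]) (use h in auto)
  then obtain s where s: "0 < s" "s < h"
    "f (x + h *\<^sub>R u + h *\<^sub>R v) - f (x + h *\<^sub>R u) - f (x + h *\<^sub>R v) + f x =
      h * (D (x + s *\<^sub>R u + h *\<^sub>R v) u - D (x + s *\<^sub>R u) u)" by auto
  define E where "E y = frechet_derivative (\<lambda>y. D y u) (at y)" for y
  have sE: "smooth_on S (\<lambda>y. D y u)" using smooth_on_deriv[OF f] by (simp add: D_def)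
  have dE: "((\<lambda>t. D (x + s *\<^sub>R u + t *\<^sub>R v) u) has_real_derivative E (x + s *\<^sub>R u + t *\<^sub>R v) v) (at t)"
    if "\<bar>t\<bar> \<le> h" for t
  proof -
    have m: "x + s *\<^sub>R u + t *\<^sub>R v \<in> S" using S s that by simp
    have "((\<lambda>t. x + s *\<^sub>R u + t *\<^sub>R v) has_derivative (\<lambda>k. k *\<^sub>R v)) (at t)"
      by (auto intro!: derivative_eq_intros)
    from diff_chain_at[OF this smooth_on_has_derivative[OF sE m]] show ?thesis
      using has_derivative_linear[OF smooth_on_has_derivative[OF sE m]]
      by (simp add: o_def E_def[symmetric] linear_scale
          has_field_derivative_def mult.commute[of _ "E _ _"])
  qed
  have "\<exists>t>0. t < h \<and> D (x + s *\<^sub>R u + h *\<^sub>R v) u - D (x + s *\<^sub>R u + 0 *\<^sub>R v) u =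
      (h - 0) * E (x + s *\<^sub>R u + t *\<^sub>R v) v"
    by (rule MVT2[OF h]) (use dE in auto)
  then obtain t where t: "0 < t" "t < h"
    "D (x + s *\<^sub>R u + h *\<^sub>R v) u - D (x + s *\<^sub>R u) u = h * E (x + s *\<^sub>R u + t *\<^sub>R v) v" by auto
  show thesis by (rule that[of s t]) (use s t in \<open>auto simp: E_def D_def\<close>)
qed

text \<open>The second difference is unchanged when \<open>u\<close> and \<open>v\<close> are
  swapped, so the two mixed derivatives agree at two points near \<open>x\<close>; by continuity
  both values are close to those at \<open>x\<close>.\<close>

lemma symmetric_second_derivative_real:
  fixes f :: "'a::euclidean_space \<Rightarrow> real"
  assumes "open S" and f: "smooth_on S f" and x: "x \<in> S"
  shows "frechet_derivative (\<lambda>y. frechet_derivative f (at y) u) (at x) v =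
    frechet_derivative (\<lambda>y. frechet_derivative f (at y) v) (at x) u" (is "?E u v x = ?E v u x")
proof -
  have cont: "continuous (at x) (?E a b)" for a b
    using smooth_on_continuous_on[OF smooth_on_deriv[OF smooth_on_deriv[OF f]]] assms(1) x
      continuous_on_eq_continuous_at by blast
  have "\<bar>?E u v x - ?E v u x\<bar> \<le> e" if "e > 0" for e
  proof -
    obtain d1 where d1: "d1 > 0" "\<And>y. dist y x < d1 \<Longrightarrow> dist (?E u v y) (?E u v x) < e/2"
      using cont[of u v] \<open>e > 0\<close> unfolding continuous_at_eps_delta by (meson half_gt_zero)
    obtain d2 where d2: "d2 > 0" "\<And>y. dist y x < d2 \<Longrightarrow> dist (?E v u y) (?E v u x) < e/2"
      using cont[of v u] \<open>e > 0\<close> unfolding continuous_at_eps_delta by (meson half_gt_zero)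
    obtain d3 where d3: "d3 > 0" "ball x d3 \<subseteq> S" using assms(1) x open_contains_ball by blast
    define d where "d = min d1 (min d2 d3)"
    \<comment> \<open>With h = d/(2N) all points x + s u + t v stay within d/2 of x. The summand 1
      keeps \<open>N\<close> positive when both directions are zero.\<close>
    define N where "N = norm u + norm v + 1"
    define h where "h = d / (2 * N)"
    have d: "d > 0" using d1 d2 d3 by (simp add: d_def)
    have pos: "N > 0" by (simp add: N_def add_nonneg_pos)
    then have h: "h > 0" using d by (simp add: h_def)
    have near: "dist (x + s *\<^sub>R u + t *\<^sub>R v) x < d" if "\<bar>s\<bar> \<le> h" "\<bar>t\<bar> \<le> h" for s t
    proof -
      have "norm (s *\<^sub>R u + t *\<^sub>R v) \<le> h * norm u + h * norm v"
        by (rule norm_triangle_le) (use that in \<open>auto intro!: add_mono mult_right_mono\<close>)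
      also have "\<dots> \<le> h * N" using h by (simp add: N_def algebra_simps)
      also have "\<dots> = d / 2"
        using pos by (simp add: h_def)
      finally show ?thesis using d by (simp add: dist_norm algebra_simps)
    qed
    have S1: "x + s *\<^sub>R u + t *\<^sub>R v \<in> S" if "\<bar>s\<bar> \<le> h" "\<bar>t\<bar> \<le> h" for s t
      using near[OF that] d3 by (auto simp: d_def dist_commute)
    have S2: "x + s *\<^sub>R v + t *\<^sub>R u \<in> S" if "\<bar>s\<bar> \<le> h" "\<bar>t\<bar> \<le> h" for s t
      using S1[OF that(2,1)] by (simp add: algebra_simps)
    obtain s t where st: "\<bar>s\<bar> \<le> h" "\<bar>t\<bar> \<le> h"
      "f (x + h *\<^sub>R u + h *\<^sub>R v) - f (x + h *\<^sub>R u) - f (x + h *\<^sub>R v) + f x =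
        h * h * ?E u v (x + s *\<^sub>R u + t *\<^sub>R v)"
      using second_difference_MVT[OF f h S1] by metis
    obtain s' t' where st': "\<bar>s'\<bar> \<le> h" "\<bar>t'\<bar> \<le> h"
      "f (x + h *\<^sub>R v + h *\<^sub>R u) - f (x + h *\<^sub>R v) - f (x + h *\<^sub>R u) + f x =
        h * h * ?E v u (x + s' *\<^sub>R v + t' *\<^sub>R u)"
      using second_difference_MVT[OF f h S2] by metis
    have "x + h *\<^sub>R v + h *\<^sub>R u = x + h *\<^sub>R u + h *\<^sub>R v"
      by (simp add: algebra_simps)
    with st(3) st'(3) have "h * h * ?E u v (x + s *\<^sub>R u + t *\<^sub>R v) = h * h * ?E v u (x + s' *\<^sub>R v + t' *\<^sub>R u)"
      by (simp add: algebra_simps)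
    then have eq: "?E u v (x + s *\<^sub>R u + t *\<^sub>R v) = ?E v u (x + t' *\<^sub>R u + s' *\<^sub>R v)"
      using h by (simp add: algebra_simps)
    have "dist (?E u v (x + s *\<^sub>R u + t *\<^sub>R v)) (?E u v x) < e/2"
      by (rule d1) (use near[OF st(1,2)] in \<open>simp add: d_def\<close>)
    moreover have "dist (?E v u (x + t' *\<^sub>R u + s' *\<^sub>R v)) (?E v u x) < e/2"
      by (rule d2) (use near[OF st'(2,1)] in \<open>simp add: d_def\<close>)
    ultimately show ?thesis unfolding eq dist_real_def by linarith
  qed
  then have "\<bar>?E u v x - ?E v u x\<bar> \<le> 0" by (rule field_le_epsilon) simp
  then show ?thesis by simp
qed

text \<open>The mean value theorem is about real functions, hence the passage to the components
  along \<open>Basis\<close>.\<close>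

lemma symmetric_second_derivative:
  fixes f :: "'a::euclidean_space \<Rightarrow> 'b::euclidean_space"
  assumes "open S" and f: "smooth_on S f" and x: "x \<in> S"
  shows "frechet_derivative (\<lambda>y. frechet_derivative f (at y) u) (at x) v =
    frechet_derivative (\<lambda>y. frechet_derivative f (at y) v) (at x) u"
proof (rule euclidean_eqI)
  fix b :: 'b
  let ?f = "\<lambda>y. f y \<bullet> b"
  have 1: "frechet_derivative ?f (at y) = (\<lambda>a. frechet_derivative f (at y) a \<bullet> b)" if "y \<in> S" for y
    by (rule frechet_derivative_eqI has_derivative_inner_left smooth_on_has_derivative[OF f that])+
  have 2: "frechet_derivative (\<lambda>y. frechet_derivative ?f (at y) c) (at x) d =
      frechet_derivative (\<lambda>y. frechet_derivative f (at y) c) (at x) d \<bullet> b" for c d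
  proof -
    have *: "((\<lambda>y. frechet_derivative f (at y) c \<bullet> b) has_derivative
       (\<lambda>d. frechet_derivative (\<lambda>y. frechet_derivative f (at y) c) (at x) d \<bullet> b)) (at x)"
      by (rule has_derivative_inner_left smooth_on_has_derivative[OF smooth_on_deriv[OF f] x])+
    have "((\<lambda>y. frechet_derivative ?f (at y) c) has_derivative
       (\<lambda>d. frechet_derivative (\<lambda>y. frechet_derivative f (at y) c) (at x) d \<bullet> b)) (at x)"
      by (rule has_derivative_transform_within_open[OF * assms(1) x]) (simp add: 1)
    then show ?thesis by (simp add: frechet_derivative_eqI)
  qed
  show "frechet_derivative (\<lambda>y. frechet_derivative f (at y) u) (at x) v \<bullet> b =
    frechet_derivative (\<lambda>y. frechet_derivative f (at y) v) (at x) u \<bullet> b"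
    using symmetric_second_derivative_real[OF assms(1) smooth_on_inner[OF assms(1) f] x, of b u v]
    by (simp only: 2)
qed

section \<open>Product rules for linear and bilinear maps varying with the point\<close>

lemma has_derivative_linear_family:
  fixes V :: "'a::real_normed_vector \<Rightarrow> 'b::euclidean_space" and L :: "'a \<Rightarrow> 'b \<Rightarrow> 'c::real_normed_vector"
  assumes "open S" "x \<in> S" "\<And>y. y \<in> S \<Longrightarrow> linear (L y)"
    and L: "\<And>v. ((\<lambda>y. L y v) has_derivative L' v) (at x)"
    and V: "(V has_derivative V') (at x)"
  shows "((\<lambda>y. L y (V y)) has_derivative (\<lambda>u. L' (V x) u + L x (V' u))) (at x)"
proof -
  have 1: "((\<lambda>y. L y (W y)) has_derivative (\<lambda>u. (\<Sum>b\<in>Basis. (W x \<bullet> b) *\<^sub>R L' b u) + L x (W' u))) (at x)"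
    if W: "(W has_derivative W') (at x)" for W W'
  proof -
    have "((\<lambda>y. \<Sum>b\<in>Basis. (W y \<bullet> b) *\<^sub>R L y b) has_derivative
        (\<lambda>u. \<Sum>b\<in>Basis. (W x \<bullet> b) *\<^sub>R L' b u + (W' u \<bullet> b) *\<^sub>R L x b)) (at x)"
      by (intro has_derivative_sum has_derivative_scaleR has_derivative_inner_left W L)
    then have "((\<lambda>y. L y (W y)) has_derivative
        (\<lambda>u. \<Sum>b\<in>Basis. (W x \<bullet> b) *\<^sub>R L' b u + (W' u \<bullet> b) *\<^sub>R L x b)) (at x)"
      by (rule has_derivative_transform_within_open[OF _ assms(1,2)])
        (simp add: linear_Basis_expansion[OF assms(3), symmetric])
    then show ?thesis
      by (simp add: sum.distrib linear_Basis_expansion[OF assms(3)[OF \<open>x \<in> S\<close>], symmetric])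
  qed
  \<comment> \<open>Linearity of \<open>L'\<close> in its first argument is not a hypothesis. It
    comes from uniqueness of the derivative: for the constant field with value \<open>V x\<close>
    the expansion and the given \<open>L'\<close> must agree.\<close>
  have "(\<lambda>u. (\<Sum>b\<in>Basis. (V x \<bullet> b) *\<^sub>R L' b u) + L x 0) = L' (V x)"
    by (rule has_derivative_unique[OF 1[OF has_derivative_const[of "V x"]] L])
  from fun_cong[OF this] have "(\<Sum>b\<in>Basis. (V x \<bullet> b) *\<^sub>R L' b u) = L' (V x) u" for u
    using linear_0[OF assms(3)[OF \<open>x \<in> S\<close>]] by simp
  with 1[OF V] show ?thesis by simp
qed

text \<open>The linear product rule applied to one slot at a time, first with \<open>w\<close> held
  fixed.\<close>

lemma has_derivative_bilinear_family:
  fixes V W :: "'a::real_normed_vector \<Rightarrow> 'b::euclidean_space" and G :: "'a \<Rightarrow> 'b \<Rightarrow> 'b \<Rightarrow> 'c::real_normed_vector"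
  assumes "open S" "x \<in> S" "\<And>y. y \<in> S \<Longrightarrow> bilinear (G y)"
    and G: "\<And>v w. ((\<lambda>y. G y v w) has_derivative G' v w) (at x)"
    and V: "(V has_derivative V') (at x)" and W: "(W has_derivative W') (at x)"
  shows "((\<lambda>y. G y (V y) (W y)) has_derivative
    (\<lambda>u. G' (V x) (W x) u + G x (V' u) (W x) + G x (V x) (W' u))) (at x)"
proof -
  have "((\<lambda>y. G y (V y) w) has_derivative (\<lambda>u. G' (V x) w u + G x (V' u) w)) (at x)" for w
    by (rule has_derivative_linear_family[where L = "\<lambda>y v. G y v w", OF assms(1,2) _ G V])
      (use assms(3) in \<open>simp add: bilinear_def\<close>)
  from has_derivative_linear_family[where L = "\<lambda>y. G y (V y)", OF assms(1,2) _ this W]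
  show ?thesis using assms(3) by (simp add: bilinear_def)
qed

section \<open>Tangent vectors and connections in charts\<close>

text \<open>Inverse to reading off the coordinates in \<open>c\<close>. With \<open>u\<close> fixed
  and \<open>p\<close> varying it is the field with constant coordinates \<open>u\<close> on the
  chart domain, the test field on which all assumptions about connections and metrics are
  evaluated.\<close>

definition tvec_of ::
  "('m, 'e::euclidean_space) chart set \<Rightarrow> ('m, 'e) chart \<Rightarrow> 'm \<Rightarrow> 'e \<Rightarrow> ('m, 'e) tvec"
  where "tvec_of A c p u = (\<lambda>d. if d \<in> charts_at A p
    then frechet_derivative (snd d \<circ> chart_inv c) (at (snd c p)) u else 0)"

lemma charts_at_iff: "c \<in> charts_at A p \<longleftrightarrow> c \<in> A \<and> p \<in> fst c"
  by (simp add: charts_at_def)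

lemma tangent_space_outside: "v \<in> tangent_space A p \<Longrightarrow> c \<notin> charts_at A p \<Longrightarrow> v c = 0"
  by (simp add: tangent_space_def del: split_paired_All)

lemma tangent_space_transition:
  "v \<in> tangent_space A p \<Longrightarrow> c \<in> charts_at A p \<Longrightarrow> d \<in> charts_at A p \<Longrightarrow>
    v d = frechet_derivative (snd d \<circ> chart_inv c) (at (snd c p)) (v c)"
  unfolding tangent_space_def by blast

lemma smooth_vector_field_on_tangent:
  "smooth_vector_field_on A U X \<Longrightarrow> p \<in> U \<Longrightarrow> X p \<in> tangent_space A p"
  by (simp add: smooth_vector_field_on_def)

lemma smooth_vector_field_on_subset:
  "smooth_vector_field_on A U X \<Longrightarrow> open V \<Longrightarrow> V \<subseteq> U \<Longrightarrow> smooth_vector_field_on A V X"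
  unfolding smooth_vector_field_on_def
  by (auto intro: smooth_on_subset simp: subset_iff)

locale atlas =
  fixes A :: "('m::{t2_space, second_countable_topology}, 'e::euclidean_space) chart set"
  assumes smooth_atlas: "smooth_atlas A"
begin

lemma
  assumes "c \<in> A"
  shows open_chart: "open (fst c)"
    and homeomorphism_chart: "homeomorphism (fst c) (snd c ` fst c) (snd c) (chart_inv c)"
    and open_chart_range: "open (snd c ` fst c)"
  using smooth_atlas assms by (auto simp: smooth_atlas_def is_chart_def)

lemma chart_inv_chart [simp]: "c \<in> A \<Longrightarrow> p \<in> fst c \<Longrightarrow> chart_inv c (snd c p) = p"
  using homeomorphism_chart by (simp add: homeomorphism_def)

lemma open_chart_image:
  assumes "c \<in> A" "open V"
  shows "open (snd c ` (fst c \<inter> V))"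
proof -
  have "snd c ` (fst c \<inter> V) = snd c ` fst c \<inter> chart_inv c -` V"
    using assms(1) by auto
  moreover have "continuous_on (snd c ` fst c) (chart_inv c)"
    using homeomorphism_chart[OF assms(1)] by (simp add: homeomorphism_def)
  ultimately show ?thesis
    using open_chart_range[OF assms(1)] assms(2) by (metis continuous_on_open_vimage Int_commute)
qed

lemma smooth_transition:
  "c \<in> A \<Longrightarrow> d \<in> A \<Longrightarrow> smooth_on (snd c ` (fst c \<inter> fst d)) (snd d \<circ> chart_inv c)"
  using smooth_atlas by (simp add: smooth_atlas_def)

lemma transition_has_derivative:
  assumes "c \<in> charts_at A p" "d \<in> charts_at A p"
  shows "((snd d \<circ> chart_inv c) has_derivative
    frechet_derivative (snd d \<circ> chart_inv c) (at (snd c p))) (at (snd c p))"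
  using assms by (intro smooth_on_has_derivative[OF smooth_transition]) (auto simp: charts_at_iff)

lemma has_derivative_change_chart:
  assumes "c \<in> charts_at A p" "d \<in> charts_at A p"
    and f: "((f \<circ> chart_inv c) has_derivative f') (at (snd c p))"
  shows "((f \<circ> chart_inv d) has_derivative
    f' \<circ> frechet_derivative (snd c \<circ> chart_inv d) (at (snd d p))) (at (snd d p))"
proof -
  have "((f \<circ> chart_inv c) \<circ> (snd c \<circ> chart_inv d) has_derivative
      f' \<circ> frechet_derivative (snd c \<circ> chart_inv d) (at (snd d p))) (at (snd d p))"
    by (rule diff_chain_at[OF transition_has_derivative]) (use assms in \<open>auto simp: charts_at_iff\<close>)
  then show ?thesis
    by (rule has_derivative_transform_within_open[where s = "snd d ` (fst d \<inter> fst c)"])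
      (use assms open_chart_image open_chart in \<open>auto simp: charts_at_iff\<close>)
qed

text \<open>The change of chart rule for the function \<open>snd e\<close>.\<close>

lemma transition_cocycle:
  assumes "c \<in> charts_at A p" "d \<in> charts_at A p" "e \<in> charts_at A p"
  shows "frechet_derivative (snd e \<circ> chart_inv d) (at (snd d p))
      (frechet_derivative (snd d \<circ> chart_inv c) (at (snd c p)) u) =
    frechet_derivative (snd e \<circ> chart_inv c) (at (snd c p)) u"
  using frechet_derivative_eqI[OF has_derivative_change_chart[OF assms(2,1)
        transition_has_derivative[OF assms(2,3)]]] by simp

lemma transition_self:
  assumes "c \<in> charts_at A p"
  shows "frechet_derivative (snd c \<circ> chart_inv c) (at (snd c p)) u = u"
proof -
  have "((\<lambda>x. x) has_derivative (\<lambda>x. x)) (at (snd c p))" by simp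
  then have "((snd c \<circ> chart_inv c) has_derivative (\<lambda>x. x)) (at (snd c p))"
    by (rule has_derivative_transform_within_open[where s = "snd c ` fst c"])
      (use assms open_chart_range in \<open>auto simp: charts_at_iff\<close>)
  then show ?thesis by (simp add: frechet_derivative_eqI)
qed

lemma linear_transition:
  "c \<in> charts_at A p \<Longrightarrow> d \<in> charts_at A p \<Longrightarrow>
    linear (frechet_derivative (snd d \<circ> chart_inv c) (at (snd c p)))"
  using transition_has_derivative has_derivative_linear by blast

text \<open>The change of chart for the function and the transformation law of \<open>v\<close>
  cancel, so the chart chosen by \<open>SOME\<close> can be replaced by any convenient one.\<close>

lemma dir_deriv_chart:
  assumes "c \<in> charts_at A p" "v \<in> tangent_space A p"
    and f: "((f \<circ> chart_inv c) has_derivative f') (at (snd c p))"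
  shows "dir_deriv A p v f = f' (v c)"
proof -
  define d where "d = (SOME c. c \<in> charts_at A p)"
  have d: "d \<in> charts_at A p" unfolding d_def by (rule someI[of _ c]) (rule assms)
  show ?thesis
    by (simp add: dir_deriv_def d_def[symmetric] tangent_space_transition[OF assms(2) d assms(1), symmetric]
        frechet_derivative_eqI[OF has_derivative_change_chart[OF assms(1) d f]])
qed

lemma tvec_of_in_tangent_space: "c \<in> charts_at A p \<Longrightarrow> tvec_of A c p u \<in> tangent_space A p"
  by (auto simp: tangent_space_def tvec_of_def transition_cocycle)

lemma tvec_of_chart [simp]: "c \<in> charts_at A p \<Longrightarrow> tvec_of A c p u c = u"
  by (simp add: tvec_of_def transition_self)

lemma tvec_of_coord: "v \<in> tangent_space A p \<Longrightarrow> c \<in> charts_at A p \<Longrightarrow> tvec_of A c p (v c) = v"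
  by (rule ext) (auto simp: tvec_of_def tangent_space_transition[symmetric] tangent_space_outside)

lemma tangent_space_eqI:
  "v \<in> tangent_space A p \<Longrightarrow> w \<in> tangent_space A p \<Longrightarrow> c \<in> charts_at A p \<Longrightarrow> v c = w c \<Longrightarrow> v = w"
  by (metis tvec_of_coord)

lemma tvec_of_linear_combination:
  "c \<in> charts_at A p \<Longrightarrow> tvec_of A c p (a *\<^sub>R u + v) = (\<lambda>d. a *\<^sub>R tvec_of A c p u d + tvec_of A c p v d)"
  using linear_transition[of c p] by (auto simp: tvec_of_def linear_add linear_scale)

lemma tangent_space_linear_combination:
  "c \<in> charts_at A p \<Longrightarrow> v \<in> tangent_space A p \<Longrightarrow> w \<in> tangent_space A p \<Longrightarrow>
    (\<lambda>d. a *\<^sub>R v d + w d) \<in> tangent_space A p"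
  using tvec_of_linear_combination[of c p a "v c" "w c"] tvec_of_in_tangent_space[of c p "a *\<^sub>R v c + w c"]
  by (simp add: tvec_of_coord)

lemma zero_in_tangent_space: "c \<in> charts_at A p \<Longrightarrow> (\<lambda>_. 0) \<in> tangent_space A p"
  using linear_transition by (auto simp: tangent_space_def linear_0)

lemma tangent_space_diff:
  "c \<in> charts_at A p \<Longrightarrow> v \<in> tangent_space A p \<Longrightarrow> w \<in> tangent_space A p \<Longrightarrow>
    (\<lambda>d. v d - w d) \<in> tangent_space A p"
  using tangent_space_linear_combination[of c p w v "-1"] by simp

lemma tangent_space_sum:
  assumes "c \<in> charts_at A p" "\<And>j. j \<in> J \<Longrightarrow> v j \<in> tangent_space A p"
  shows "(\<lambda>d. \<Sum>j\<in>J. a j *\<^sub>R v j d) \<in> tangent_space A p"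
  using assms(2)
  by (induction J rule: infinite_finite_induct)
    (simp_all add: zero_in_tangent_space[OF assms(1)] tangent_space_linear_combination[OF assms(1)])

text \<open>In a chart \<open>d\<close> the coordinates are a directional derivative of the
  transition from \<open>c\<close> to \<open>d\<close>, precomposed with the transition back; both
  are smooth on the overlap.\<close>

lemma smooth_vector_field_on_tvec_of:
  assumes "c \<in> A"
  shows "smooth_vector_field_on A (fst c) (\<lambda>q. tvec_of A c q u)"
  unfolding smooth_vector_field_on_def
proof (intro conjI ballI)
  show "open (fst c)" "fst c \<subseteq> carrier_of A"
    using assms open_chart by (auto simp: carrier_of_def)
  show "tvec_of A c q u \<in> tangent_space A q" if "q \<in> fst c" for q
    using that assms by (simp add: tvec_of_in_tangent_space charts_at_iff)
  fix d assume d: "d \<in> A"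
  let ?S = "snd d ` (fst d \<inter> fst c)" and ?T = "snd c ` (fst c \<inter> fst d)"
  have op: "open ?S" "open ?T" using assms d by (simp_all add: open_chart_image open_chart)
  have "smooth_on ?S ((\<lambda>y. frechet_derivative (snd d \<circ> chart_inv c) (at y) u) \<circ> (snd c \<circ> chart_inv d))"
    by (rule smooth_on_compose[OF op _ smooth_transition[OF d assms]
          smooth_on_deriv[OF smooth_transition[OF assms d]]]) (use assms d in auto)
  then show "smooth_on ?S (\<lambda>x. tvec_of A c (chart_inv d x) u d)"
    by (rule smooth_on_cong[OF op(1), rotated])
      (use d in \<open>auto simp: tvec_of_def charts_at_iff\<close>)
qed

lemma smooth_vector_field_on_has_derivative:
  assumes "smooth_vector_field_on A U X" "p \<in> U" "c \<in> charts_at A p"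
  shows "(((\<lambda>q. X q c) \<circ> chart_inv c) has_derivative
    frechet_derivative ((\<lambda>q. X q c) \<circ> chart_inv c) (at (snd c p))) (at (snd c p))"
  using assms unfolding smooth_vector_field_on_def o_def
  by (intro smooth_on_has_derivative[where S = "snd c ` (fst c \<inter> U)"]) (auto simp: charts_at_iff)

lemma coord_tvec_of_has_derivative:
  assumes "c \<in> charts_at A p"
  shows "(((\<lambda>q. tvec_of A c q u c) \<circ> chart_inv c) has_derivative (\<lambda>_. 0)) (at (snd c p))"
  by (rule has_derivative_transform_within_open[OF has_derivative_const[of u], where s = "snd c ` fst c"])
    (use assms open_chart_range in \<open>auto simp: charts_at_iff\<close>)

lemma cov_deriv_chart:
  assumes "c \<in> charts_at A p" "X p \<in> tangent_space A p"
    and "(((\<lambda>q. Y q c) \<circ> chart_inv c) has_derivative Y') (at (snd c p))"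
  shows "cov_deriv A \<Gamma> X Y p c = Y' (X p c) + \<Gamma> c p (X p c) (Y p c)"
  using dir_deriv_chart[OF assms] assms(1) by (simp add: cov_deriv_def)

lemma lie_bracket_chart:
  assumes "c \<in> charts_at A p" "X p \<in> tangent_space A p" "Y p \<in> tangent_space A p"
    and "(((\<lambda>q. Y q c) \<circ> chart_inv c) has_derivative Y') (at (snd c p))"
    and "(((\<lambda>q. X q c) \<circ> chart_inv c) has_derivative X') (at (snd c p))"
  shows "lie_bracket A X Y p c = Y' (X p c) - X' (Y p c)"
  using dir_deriv_chart[OF assms(1,2,4)] dir_deriv_chart[OF assms(1,3,5)] assms(1)
  by (simp add: lie_bracket_def)

end

section \<open>The Levi-Civita connection in coordinates\<close>

text \<open>Collects what follows from the Levi-Civita identities alone. The rigged metric on L is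
  used later through this interface, the ambient metric through its extension
  \<open>levi_civita_atlas\<close>.\<close>

locale connection_atlas = atlas A
  for A :: "('m::{t2_space, second_countable_topology}, 'e::euclidean_space) chart set" +
  fixes g :: "('m, 'e) metric" and \<Gamma> :: "('m, 'e) christoffel"
  assumes levi_civita: "levi_civita A g \<Gamma>"
begin

lemma affine_connection: "affine_connection A \<Gamma>"
  using levi_civita by (simp add: levi_civita_def)

lemma bilinear_christoffel: "c \<in> charts_at A p \<Longrightarrow> bilinear (\<Gamma> c p)"
  using affine_connection by (simp add: affine_connection_def charts_at_iff)

lemma smooth_cov_deriv:
  "smooth_vector_field_on A U X \<Longrightarrow> smooth_vector_field_on A U Y \<Longrightarrow>
    smooth_vector_field_on A U (cov_deriv A \<Gamma> X Y)"
  using affine_connection by (simp add: affine_connection_def)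

lemma torsion_free:
  "smooth_vector_field_on A U X \<Longrightarrow> smooth_vector_field_on A U Y \<Longrightarrow> p \<in> U \<Longrightarrow>
    (\<lambda>c. cov_deriv A \<Gamma> X Y p c - cov_deriv A \<Gamma> Y X p c) = lie_bracket A X Y p"
  using levi_civita unfolding levi_civita_def by blast

lemma metric_compatible:
  "smooth_vector_field_on A U X \<Longrightarrow> smooth_vector_field_on A U Y \<Longrightarrow> smooth_vector_field_on A U Z \<Longrightarrow>
    p \<in> U \<Longrightarrow> dir_deriv A p (X p) (\<lambda>q. g q (Y q) (Z q)) =
      g p (cov_deriv A \<Gamma> X Y p) (Z p) + g p (Y p) (cov_deriv A \<Gamma> X Z p)"
  using levi_civita unfolding levi_civita_def by blast

text \<open>By torsion-freeness the bracket is a difference of covariant derivatives, which are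
  vector fields; no second derivatives of transition maps enter.\<close>

lemma lie_bracket_in_tangent_space:
  assumes X: "smooth_vector_field_on A U X" and Y: "smooth_vector_field_on A U Y" and "p \<in> U"
    and c: "c \<in> charts_at A p"
  shows "lie_bracket A X Y p \<in> tangent_space A p"
  using tangent_space_diff[OF c smooth_vector_field_on_tangent[OF smooth_cov_deriv[OF X Y] \<open>p \<in> U\<close>]
      smooth_vector_field_on_tangent[OF smooth_cov_deriv[OF Y X] \<open>p \<in> U\<close>]]
    torsion_free[OF X Y \<open>p \<in> U\<close>] by simp

lemma cov_deriv_tvec_of:
  assumes c: "c \<in> charts_at A p" and "X p \<in> tangent_space A p"
  shows "cov_deriv A \<Gamma> X (\<lambda>q. tvec_of A c q v) p c = \<Gamma> c p (X p c) v"
  using cov_deriv_chart[of c p X "\<lambda>q. tvec_of A c q v" "\<lambda>_. 0" \<Gamma>, OF assms coord_tvec_of_has_derivative[OF c]]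
  by (simp add: c)

text \<open>Fields with constant coordinates commute, and their covariant derivatives consist of the
  Christoffel term only.\<close>

lemma christoffel_sym:
  assumes c: "c \<in> charts_at A p"
  shows "\<Gamma> c p u v = \<Gamma> c p v u"
proof -
  have cA: "c \<in> A" and p: "p \<in> fst c" using c by (auto simp: charts_at_iff)
  note t = tvec_of_in_tangent_space[OF c]
  have "lie_bracket A (\<lambda>q. tvec_of A c q u) (\<lambda>q. tvec_of A c q v) p c = 0"
    using lie_bracket_chart[where X = "\<lambda>q. tvec_of A c q u" and Y = "\<lambda>q. tvec_of A c q v",
        OF c t t coord_tvec_of_has_derivative[OF c] coord_tvec_of_has_derivative[OF c]] by simp
  then show ?thesis
    using fun_cong[OF torsion_free[OF smooth_vector_field_on_tvec_of[OF cA]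
          smooth_vector_field_on_tvec_of[OF cA] p], of u v c]
    by (simp add: cov_deriv_tvec_of[OF c] t c)
qed

end

locale levi_civita_atlas = connection_atlas A g \<Gamma>
  for A :: "('m::{t2_space, second_countable_topology}, 'e::euclidean_space) chart set"
    and g :: "('m, 'e) metric" and \<Gamma> :: "('m, 'e) christoffel" +
  assumes smooth_sym_tensor: "smooth_sym_tensor A g"
begin

lemma charts_at_carrier: "c \<in> charts_at A p \<Longrightarrow> p \<in> carrier_of A"
  by (auto simp: charts_at_iff carrier_of_def)

lemma metric_sym:
  "p \<in> carrier_of A \<Longrightarrow> u \<in> tangent_space A p \<Longrightarrow> v \<in> tangent_space A p \<Longrightarrow> g p u v = g p v u"
  using smooth_sym_tensor unfolding smooth_sym_tensor_def by blast

text \<open>Carries the metric to the fixed space \<open>'e\<close>, where values at different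
  points can be compared and differentiated.\<close>

definition coord_metric :: "('m, 'e) chart \<Rightarrow> 'm \<Rightarrow> 'e \<Rightarrow> 'e \<Rightarrow> real"
  where "coord_metric c p u v = g p (tvec_of A c p u) (tvec_of A c p v)"

lemma metric_coord:
  "c \<in> charts_at A p \<Longrightarrow> u \<in> tangent_space A p \<Longrightarrow> v \<in> tangent_space A p \<Longrightarrow>
    g p u v = coord_metric c p (u c) (v c)"
  by (simp add: coord_metric_def tvec_of_coord)

lemma coord_metric_sym: "c \<in> charts_at A p \<Longrightarrow> coord_metric c p u v = coord_metric c p v u"
  unfolding coord_metric_def
  by (intro metric_sym charts_at_carrier tvec_of_in_tangent_space)

lemma bilinear_coord_metric:
  assumes c: "c \<in> charts_at A p"
  shows "bilinear (coord_metric c p)"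
proof -
  have *: "coord_metric c p (a *\<^sub>R u + v) w = a * coord_metric c p u w + coord_metric c p v w" for a u v w
    using smooth_sym_tensor charts_at_carrier[OF c] tvec_of_in_tangent_space[OF c]
    unfolding smooth_sym_tensor_def coord_metric_def tvec_of_linear_combination[OF c] by blast
  \<comment> \<open>The scalar -1 and zero vectors give f(0) = - f(0) + f(0).\<close>
  have "coord_metric c p 0 w = 0" for w using *[of "-1" 0 0 w] by simp
  then have "linear (\<lambda>u. coord_metric c p u w)" for w
    using *[of 1 _ _ w] *[of _ _ 0 w] by (intro linearI) simp_all
  then show ?thesis by (simp add: bilinear_def coord_metric_sym[OF c, of _ "_ :: 'e"])
qed

lemma metric_linear_right:
  assumes "c \<in> charts_at A p" "u \<in> tangent_space A p" "v \<in> tangent_space A p" "w \<in> tangent_space A p"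
  shows "g p w (\<lambda>d. a *\<^sub>R u d + v d) = a * g p w u + g p w v"
  using bilinear_coord_metric[OF assms(1)]
  by (simp add: metric_coord[OF assms(1)] assms tangent_space_linear_combination[OF assms(1)]
      bilinear_radd bilinear_rmul)

lemma metric_add_right:
  "c \<in> charts_at A p \<Longrightarrow> u \<in> tangent_space A p \<Longrightarrow> v \<in> tangent_space A p \<Longrightarrow> w \<in> tangent_space A p \<Longrightarrow>
    g p w (\<lambda>d. u d + v d) = g p w u + g p w v"
  using metric_linear_right[of c p u v w 1] by simp

text \<open>Metric compatibility for three fields with constant coordinates, that is, the classical
  expression of the derivatives of the metric coefficients through Christoffel symbols.\<close>

lemma coord_metric_has_derivative:
  assumes c: "c \<in> charts_at A p"
  shows "((\<lambda>y. coord_metric c (chart_inv c y) v w) has_derivative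
    (\<lambda>u. coord_metric c p (\<Gamma> c p u v) w + coord_metric c p v (\<Gamma> c p u w))) (at (snd c p))"
proof -
  have cA: "c \<in> A" and p: "p \<in> fst c" using c by (auto simp: charts_at_iff)
  note t = tvec_of_in_tangent_space[OF c] and s = smooth_vector_field_on_tvec_of[OF cA]
  let ?f = "\<lambda>q. coord_metric c q v w"
  have "smooth_function_on A (fst c) ?f"
    using s[of v] s[of w] smooth_sym_tensor unfolding smooth_sym_tensor_def coord_metric_def by blast
  then have "smooth_on (snd c ` fst c) (?f \<circ> chart_inv c)"
    using cA unfolding smooth_function_on_def by (metis Int_absorb)
  then have d: "((?f \<circ> chart_inv c) has_derivative
      frechet_derivative (?f \<circ> chart_inv c) (at (snd c p))) (at (snd c p))"
    by (rule smooth_on_has_derivative) (use p in blast)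
  have "frechet_derivative (?f \<circ> chart_inv c) (at (snd c p)) u =
     coord_metric c p (\<Gamma> c p u v) w + coord_metric c p v (\<Gamma> c p u w)" for u
  proof -
    have ct: "cov_deriv A \<Gamma> (\<lambda>q. tvec_of A c q u) (\<lambda>q. tvec_of A c q a) p \<in> tangent_space A p" for a
      by (rule smooth_vector_field_on_tangent[OF smooth_cov_deriv[OF s s] p])
    have "dir_deriv A p (tvec_of A c p u) ?f = coord_metric c p (\<Gamma> c p u v) w + coord_metric c p v (\<Gamma> c p u w)"
      using metric_compatible[OF s s s p, of u v w]
      by (simp add: coord_metric_def[symmetric] metric_coord[OF c] ct t cov_deriv_tvec_of[OF c] c)
    then show ?thesis using dir_deriv_chart[OF c t d, of u] by (simp add: c)
  qed
  then have "frechet_derivative (?f \<circ> chart_inv c) (at (snd c p)) =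
     (\<lambda>u. coord_metric c p (\<Gamma> c p u v) w + coord_metric c p v (\<Gamma> c p u w))" by (rule ext)
  with d show ?thesis by (simp add: o_def)
qed

text \<open>Pairing with the orthonormal frame recovers frame coefficients up to sign. Hence the
  frame is independent and, by dimension, spanning; a vector orthogonal to it has zero
  coefficients.\<close>

lemma lorentzian_nondegenerate:
  assumes lor: "lorentzian_metric A g" and c: "c \<in> charts_at A p" and a: "a \<in> tangent_space A p"
    and orth: "\<And>v. v \<in> tangent_space A p \<Longrightarrow> g p a v = 0"
  shows "a = (\<lambda>_. 0)"
proof -
  obtain E :: "'e \<Rightarrow> ('m, 'e) tvec" and b\<^sub>0 where "\<forall>b\<in>Basis. E b \<in> tangent_space A p"
    "\<forall>b\<in>Basis. \<forall>b'\<in>Basis.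
       g p (E b) (E b') = (if b \<noteq> b' then 0 else if b = b\<^sub>0 then - 1 else 1)"
    using bspec[OF conjunct2[OF lor[unfolded lorentzian_metric_def]] charts_at_carrier[OF c]] by blast
  then have E: "\<And>b. b \<in> Basis \<Longrightarrow> E b \<in> tangent_space A p"
    "\<And>b b'. b \<in> Basis \<Longrightarrow> b' \<in> Basis \<Longrightarrow>
       g p (E b) (E b') = (if b \<noteq> b' then 0 else if b = b\<^sub>0 then - 1 else 1)"
    by auto
  \<comment> \<open>\<open>S\<close> turns frame coefficients into coordinates in \<open>c\<close>,
    so that spanning becomes surjectivity of an injective endomorphism of \<open>'e\<close>.\<close>
  define S :: "'e \<Rightarrow> 'e" where "S w = (\<Sum>b\<in>Basis. (w \<bullet> b) *\<^sub>R E b c)" for w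
  define h where "h w b = coord_metric c p w (E b c)" for w b
  note bil = bilinear_coord_metric[OF c]
  have hlin: "linear (\<lambda>w. h w b)" for b using bil by (simp add: h_def bilinear_def)
  have S: "linear S"
    unfolding S_def by (intro linearI) (simp_all add: inner_add_left scaleR_left_distrib sum.distrib scaleR_sum_right)
  have hS: "h (S w) b = (w \<bullet> b) * (if b = b\<^sub>0 then - 1 else 1)" if "b \<in> Basis" for w b
  proof -
    have "h (S w) b = (\<Sum>b'\<in>Basis. (w \<bullet> b') * h (E b' c) b)"
      unfolding S_def by (simp add: linear_sum[OF hlin] linear_scale[OF hlin])
    also have "\<dots> = (\<Sum>b'\<in>Basis. if b' = b then (w \<bullet> b) * (if b = b\<^sub>0 then - 1 else 1) else 0)"
      by (rule sum.cong) (use E that in \<open>auto simp: h_def metric_coord[OF c, symmetric]\<close>)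
    finally show ?thesis using that by (simp add: sum.delta)
  qed
  have "inj S"
  proof (rule linear_injective_0[THEN iffD2, OF S], intro allI impI)
    fix w assume "S w = 0"
    then have "w \<bullet> b = 0" if "b \<in> Basis" for b
      using hS[OF that, of w] linear_0[OF hlin[of b]] by (simp split: if_splits)
    then show "w = 0" using euclidean_all_zero_iff by blast
  qed
  then have "surj S" using linear_injective_imp_surjective[OF S] by blast
  then obtain w where w: "a c = S w" by (metis surjD)
  have "w \<bullet> b = 0" if "b \<in> Basis" for b
    using hS[OF that, of w] orth[OF E(1)[OF that]] metric_coord[OF c a E(1)[OF that]] w
    by (simp add: h_def split: if_splits)
  then have "w = 0" using euclidean_all_zero_iff by blast
  then have "a c = 0" using w linear_0[OF S] by simp
  then show ?thesis using tangent_space_eqI[OF a zero_in_tangent_space[OF c] c] by simp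
qed

text \<open>With \<open>[\<zeta>,X] = \<nabla>\<^sub>\<zeta> X - \<nabla>\<^sub>X \<zeta>\<close> the derivatives along \<open>\<zeta>\<close> cancel in \<open>L\<^sub>\<zeta> g\<close>.\<close>

lemma conformal_field_coord:
  assumes conf: "conformal_field_on A g U Z" and Z: "smooth_vector_field_on A U Z"
    and "p \<in> U" and c: "c \<in> charts_at A p"
    and Z': "(((\<lambda>q. Z q c) \<circ> chart_inv c) has_derivative Z') (at (snd c p))"
  obtains \<sigma> where "\<And>u v. coord_metric c p (Z' u + \<Gamma> c p u (Z p c)) v +
    coord_metric c p u (Z' v + \<Gamma> c p v (Z p c)) = 2 * \<sigma> * coord_metric c p u v"
proof -
  have cA: "c \<in> A" and p: "p \<in> fst c" using c by (auto simp: charts_at_iff)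
  note t = tvec_of_in_tangent_space[OF c]
  \<comment> \<open>The test fields are smooth only on the chart domain, so conformality is used on
    this smaller open set.\<close>
  let ?V = "U \<inter> fst c"
  have op: "open ?V" using Z open_chart[OF cA] by (auto simp: smooth_vector_field_on_def)
  have s: "smooth_vector_field_on A ?V (\<lambda>q. tvec_of A c q u)" for u
    by (rule smooth_vector_field_on_subset[OF smooth_vector_field_on_tvec_of[OF cA] op]) simp
  have sZ: "smooth_vector_field_on A ?V Z"
    by (rule smooth_vector_field_on_subset[OF Z op]) simp
  have pV: "p \<in> ?V" using \<open>p \<in> U\<close> p by simp
  from conf obtain \<sigma> where \<sigma>: "\<And>u v. lie_deriv_metric A g Z (\<lambda>q. tvec_of A c q u) (\<lambda>q. tvec_of A c q v) p =
      2 * \<sigma> p * coord_metric c p u v"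
    unfolding conformal_field_on_def coord_metric_def using s pV Int_lower1 by meson
  show thesis
  proof (rule that)
    fix u v
    let ?X = "\<lambda>a q. tvec_of A c q a"
    note lb = lie_bracket_in_tangent_space[OF sZ s pV c]
    note cd = smooth_vector_field_on_tangent[OF smooth_cov_deriv[OF sZ s] pV]
    note bil = bilinear_coord_metric[OF c]
    have lbc: "lie_bracket A Z (?X a) p c =
        cov_deriv A \<Gamma> Z (?X a) p c - (Z' a + \<Gamma> c p a (Z p c))" for a
      using fun_cong[OF torsion_free[OF sZ s pV, of a], of c]
        cov_deriv_chart[of c p "?X a" Z Z' \<Gamma>, OF c t Z'] by (simp add: c)
    have "lie_deriv_metric A g Z (?X u) (?X v) p =
      coord_metric c p (cov_deriv A \<Gamma> Z (?X u) p c) v + coord_metric c p u (cov_deriv A \<Gamma> Z (?X v) p c)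
      - coord_metric c p (lie_bracket A Z (?X u) p c) v - coord_metric c p u (lie_bracket A Z (?X v) p c)"
      unfolding lie_deriv_metric_def metric_compatible[OF sZ s s pV]
      by (simp add: metric_coord[OF c] lb cd t c)
    then show "coord_metric c p (Z' u + \<Gamma> c p u (Z p c)) v +
      coord_metric c p u (Z' v + \<Gamma> c p v (Z p c)) = 2 * \<sigma> p * coord_metric c p u v"
      unfolding lbc bilinear_lsub[OF bil] bilinear_rsub[OF bil] \<sigma> by simp
  qed
qed

end

section \<open>The pulled back connection\<close>

locale immersion = levi_civita_atlas A g \<Gamma> + source: atlas B
  for A :: "('m::{t2_space, second_countable_topology}, 'e::euclidean_space) chart set"
    and g :: "('m, 'e) metric" and \<Gamma> :: "('m, 'e) christoffel"
    and B :: "('n::{t2_space, second_countable_topology}, 'l::euclidean_space) chart set" +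
  fixes i :: "'n \<Rightarrow> 'm"
  assumes smooth_map: "smooth_map B A i"
begin

abbreviation map_rep where "map_rep b c \<equiv> snd c \<circ> i \<circ> chart_inv b"

abbreviation map_dom where "map_dom b c \<equiv> snd b ` (fst b \<inter> i -` fst c)"

abbreviation differential_rep where
  "differential_rep b c p \<equiv> frechet_derivative (map_rep b c) (at (snd b p))"

lemma open_map_dom:
  assumes "b \<in> B" "c \<in> A"
  shows "open (map_dom b c)"
proof -
  have "open (carrier_of B)" using source.open_chart by (auto simp: carrier_of_def)
  then have "open (i -` fst c \<inter> carrier_of B)"
    using smooth_map open_chart[OF assms(2)] continuous_on_open_vimage unfolding smooth_map_def by blast
  moreover have "fst b \<inter> i -` fst c = fst b \<inter> (i -` fst c \<inter> carrier_of B)"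
    using assms(1) by (auto simp: carrier_of_def)
  ultimately show ?thesis using source.open_chart_image[OF assms(1)] by metis
qed

lemma smooth_map_rep: "b \<in> B \<Longrightarrow> c \<in> A \<Longrightarrow> smooth_on (map_dom b c) (map_rep b c)"
  using smooth_map by (simp add: smooth_map_def)

lemma in_map_dom: "b \<in> charts_at B p \<Longrightarrow> c \<in> charts_at A (i p) \<Longrightarrow> snd b p \<in> map_dom b c"
  by (auto simp: charts_at_iff)

lemma map_rep_has_derivative:
  "b \<in> charts_at B p \<Longrightarrow> c \<in> charts_at A (i p) \<Longrightarrow>
    (map_rep b c has_derivative differential_rep b c p) (at (snd b p))"
  by (rule smooth_on_has_derivative[OF smooth_map_rep in_map_dom]) (simp_all add: charts_at_iff)

lemma linear_differential_rep:
  "b \<in> charts_at B p \<Longrightarrow> c \<in> charts_at A (i p) \<Longrightarrow> linear (differential_rep b c p)"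
  using map_rep_has_derivative has_derivative_linear by blast

lemma has_derivative_along:
  assumes b: "b \<in> charts_at B p" and c: "c \<in> charts_at A (i p)"
    and f: "((f \<circ> chart_inv c) has_derivative f') (at (snd c (i p)))"
  shows "((f \<circ> i \<circ> chart_inv b) has_derivative f' \<circ> differential_rep b c p) (at (snd b p))"
proof -
  have "((f \<circ> chart_inv c) \<circ> map_rep b c has_derivative f' \<circ> differential_rep b c p) (at (snd b p))"
    by (rule diff_chain_at[OF map_rep_has_derivative[OF b c]]) (use f b in \<open>simp add: charts_at_iff\<close>)
  then show ?thesis
    by (rule has_derivative_transform_within_open[where s = "map_dom b c"])
      (use b c open_map_dom in \<open>auto simp: charts_at_iff\<close>)
qed

lemma differential_chart:
  assumes b: "b \<in> charts_at B p" and c: "c \<in> charts_at A (i p)" and v: "v \<in> tangent_space B p"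
  shows "differential B A i p v c = differential_rep b c p (v b)"
  using source.dir_deriv_chart[OF b v map_rep_has_derivative[OF b c]] c
  by (simp add: differential_def)

lemma differential_rep_transition:
  assumes b: "b \<in> charts_at B p" and c: "c \<in> charts_at A (i p)" and d: "d \<in> charts_at A (i p)"
  shows "differential_rep b d p u =
    frechet_derivative (snd d \<circ> chart_inv c) (at (snd c (i p))) (differential_rep b c p u)"
  using frechet_derivative_eqI[OF has_derivative_along[OF b c transition_has_derivative[OF c d]]] by simp

lemma carrier_image: "p \<in> carrier_of B \<Longrightarrow> i p \<in> carrier_of A"
  using smooth_map by (auto simp: smooth_map_def)

lemma carrier_charts:
  assumes "p \<in> carrier_of B"
  obtains b c where "b \<in> charts_at B p" "c \<in> charts_at A (i p)"
  using assms carrier_image[OF assms] unfolding carrier_of_def charts_at_def by blast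

lemma differential_in_tangent_space:
  assumes v: "v \<in> tangent_space B p" and p: "p \<in> carrier_of B"
  shows "differential B A i p v \<in> tangent_space A (i p)"
proof -
  obtain b where b: "b \<in> charts_at B p" using carrier_charts[OF p] by blast
  show ?thesis
    unfolding tangent_space_def mem_Collect_eq
  proof (intro conjI ballI allI impI)
    fix c d assume c: "c \<in> charts_at A (i p)" and d: "d \<in> charts_at A (i p)"
    show "differential B A i p v d = frechet_derivative (snd d \<circ> chart_inv c) (at (snd c (i p)))
        (differential B A i p v c)"
      unfolding differential_chart[OF b c v] differential_chart[OF b d v]
      by (rule differential_rep_transition[OF b c d])
  qed (simp add: differential_def)
qed

lemma differential_linear_combination:
  assumes u: "u \<in> tangent_space B p" and v: "v \<in> tangent_space B p" and p: "p \<in> carrier_of B"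
  shows "differential B A i p (\<lambda>d. a *\<^sub>R u d + v d) =
    (\<lambda>d. a *\<^sub>R differential B A i p u d + differential B A i p v d)"
proof -
  obtain b where b: "b \<in> charts_at B p" using carrier_charts[OF p] by blast
  have "differential B A i p (\<lambda>d. a *\<^sub>R u d + v d) c =
    a *\<^sub>R differential B A i p u c + differential B A i p v c" if c: "c \<in> charts_at A (i p)" for c
    using linear_differential_rep[OF b c]
    by (simp add: differential_chart[OF b c] u v source.tangent_space_linear_combination[OF b]
        linear_add linear_scale)
  then show ?thesis by (auto simp: differential_def)
qed

lemma differential_add:
  "u \<in> tangent_space B p \<Longrightarrow> v \<in> tangent_space B p \<Longrightarrow> p \<in> carrier_of B \<Longrightarrow>
    differential B A i p (\<lambda>d. u d + v d) = (\<lambda>d. differential B A i p u d + differential B A i p v d)"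
  using differential_linear_combination[of u p v 1] by simp

section \<open>Vector fields along the immersion\<close>

text \<open>Tangency is required on the whole chart domain because a change of ambient chart
  involves values near \<open>p\<close>. The derivative at \<open>p\<close> is an explicit witness,
  so that formulas for it can be passed on.\<close>

definition field_along where
  "field_along b c p V V' \<longleftrightarrow> (\<forall>q\<in>fst b. V q \<in> tangent_space A (i q)) \<and>
    (((\<lambda>q. V q c) \<circ> chart_inv b) has_derivative V') (at (snd b p))"

lemma cov_deriv_along_chart:
  assumes "b \<in> charts_at B p" "c \<in> charts_at A (i p)" "u \<in> tangent_space B p" "field_along b c p V V'"
  shows "cov_deriv_along B A i \<Gamma> p u V c =
    V' (u b) + \<Gamma> c (i p) (differential_rep b c p (u b)) (V p c)"
  using assms source.dir_deriv_chart[OF assms(1,3), of "\<lambda>q. V q c" V']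
  by (simp add: cov_deriv_along_def differential_chart field_along_def)

text \<open>
  \<open>V = \<Sum>\<^sub>j V\<^sup>j X\<^sub>j\<close> for the coordinate fields \<open>X\<^sub>j\<close> of an ambient chart, so
  \<open>\<nabla>\<^sub>u V = \<Sum>\<^sub>j u(V\<^sup>j) X\<^sub>j + V\<^sup>j \<nabla>\<^sub>u X\<^sub>j\<close> is a combination of tangent vectors.
\<close>

lemma cov_deriv_along_in_tangent_space:
  assumes b: "b \<in> charts_at B p" and c: "c \<in> charts_at A (i p)" and u: "u \<in> tangent_space B p"
    and V: "field_along b c p V V'"
  shows "cov_deriv_along B A i \<Gamma> p u V \<in> tangent_space A (i p)"
proof -
  have cA: "c \<in> A" and ip: "i p \<in> fst c" and bB: "b \<in> B" and p: "p \<in> fst b"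
    using b c by (auto simp: charts_at_iff)
  have pc: "p \<in> carrier_of B" using bB p by (auto simp: carrier_of_def)
  define X where "X j q = tvec_of A c q j" for j q
  \<comment> \<open>Extends the image of \<open>u\<close> to an ambient field with constant
    coordinates; the derivatives of the X_j along \<open>u\<close> then become values of the ambient
    connection, which are known to be tangent vectors.\<close>
  define U where "U q = tvec_of A c q (differential B A i p u c)" for q
  have sX: "smooth_vector_field_on A (fst c) (X j)" and sU: "smooth_vector_field_on A (fst c) U" for j
    unfolding X_def U_def by (rule smooth_vector_field_on_tvec_of[OF cA])+
  have tX: "X j (i p) \<in> tangent_space A (i p)" for j
    unfolding X_def by (rule tvec_of_in_tangent_space[OF c])
  have Up: "U (i p) = differential B A i p u"
    unfolding U_def by (rule tvec_of_coord[OF differential_in_tangent_space[OF u pc] c])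
  have Vt: "V q \<in> tangent_space A (i q)" if "q \<in> fst b" for q
    using V that by (simp add: field_along_def)
  have V': "(((\<lambda>q. V q c) \<circ> chart_inv b) has_derivative V') (at (snd b p))"
    using V by (simp add: field_along_def)
  have expand: "V q d = (\<Sum>j\<in>Basis. (V q c \<bullet> j) *\<^sub>R X j (i q) d)"
    if q: "q \<in> fst b" "i q \<in> fst c" and d: "d \<in> charts_at A (i q)" for q d
  proof -
    have c: "c \<in> charts_at A (i q)" using cA q by (simp add: charts_at_iff)
    show ?thesis
      unfolding X_def tvec_of_def if_P[OF d]
      by (subst linear_Basis_expansion[OF linear_transition[OF c d], symmetric],
          rule tangent_space_transition[OF Vt[OF q(1)] c d])
  qed
  have eq: "cov_deriv_along B A i \<Gamma> p u V = (\<lambda>d. 1 *\<^sub>R (\<Sum>j\<in>Basis. (V' (u b) \<bullet> j) *\<^sub>R X j (i p) d) +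
      (\<Sum>j\<in>Basis. (V p c \<bullet> j) *\<^sub>R cov_deriv A \<Gamma> U (X j) (i p) d))" (is "_ = ?R")
  proof
    fix d
    show "cov_deriv_along B A i \<Gamma> p u V d = ?R d"
    proof (cases "d \<in> charts_at A (i p)")
      case False
      then show ?thesis
        by (simp add: cov_deriv_along_def cov_deriv_def tangent_space_outside[OF tX])
    next
      case d: True
      then have dA: "d \<in> A" and id: "i p \<in> fst d" by (auto simp: charts_at_iff)
      define D where "D j = frechet_derivative ((\<lambda>q. X j q d) \<circ> chart_inv d) (at (snd d (i p)))" for j
      have DX: "(((\<lambda>q. X j q d) \<circ> chart_inv d) has_derivative D j) (at (snd d (i p)))" for j
        unfolding D_def by (rule smooth_vector_field_on_has_derivative[OF sX ip d])
      \<comment> \<open>The derivative of \<open>V\<close> is given in the chart \<open>c\<close>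
        only; the expansion in coordinate fields transfers it to the chart \<open>d\<close>.\<close>
      have "((\<lambda>x. \<Sum>j\<in>Basis. (V (chart_inv b x) c \<bullet> j) *\<^sub>R X j (i (chart_inv b x)) d) has_derivative
          (\<lambda>w. \<Sum>j\<in>Basis. (V p c \<bullet> j) *\<^sub>R D j (differential_rep b d p w) + (V' w \<bullet> j) *\<^sub>R X j (i p) d))
          (at (snd b p))"
        using V' has_derivative_along[OF b d DX]
        by (auto simp: o_def p bB intro!: derivative_eq_intros)
      then have "(((\<lambda>q. V q d) \<circ> chart_inv b) has_derivative
          (\<lambda>w. \<Sum>j\<in>Basis. (V p c \<bullet> j) *\<^sub>R D j (differential_rep b d p w) + (V' w \<bullet> j) *\<^sub>R X j (i p) d))
          (at (snd b p))"
      proof (rule has_derivative_transform_within_open[where s = "map_dom b c \<inter> map_dom b d"])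
        show "open (map_dom b c \<inter> map_dom b d)" using open_map_dom bB cA dA by blast
        show "snd b p \<in> map_dom b c \<inter> map_dom b d" using p ip id by blast
        fix x assume x: "x \<in> map_dom b c \<inter> map_dom b d"
        from IntD1[OF x] have "chart_inv b x \<in> fst b" "i (chart_inv b x) \<in> fst c" using bB by auto
        moreover from IntD2[OF x] have "i (chart_inv b x) \<in> fst d" using bB by auto
        ultimately show "(\<Sum>j\<in>Basis. (V (chart_inv b x) c \<bullet> j) *\<^sub>R X j (i (chart_inv b x)) d) =
            ((\<lambda>q. V q d) \<circ> chart_inv b) x"
          using dA by (simp add: expand charts_at_iff)
      qed
      then have V'd: "field_along b d p V (\<lambda>w. \<Sum>j\<in>Basis. (V p c \<bullet> j) *\<^sub>R D j (differential_rep b d p w) +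
          (V' w \<bullet> j) *\<^sub>R X j (i p) d)"
        using Vt by (simp add: field_along_def)
      have lin: "linear (\<Gamma> d (i p) w)" for w
        using bilinear_christoffel[OF d] by (simp add: bilinear_def)
      have "cov_deriv A \<Gamma> U (X j) (i p) d =
          D j (differential_rep b d p (u b)) + \<Gamma> d (i p) (differential_rep b d p (u b)) (X j (i p) d)" for j
        using cov_deriv_chart[of d "i p" U "X j", OF d _ DX] smooth_vector_field_on_tangent[OF sU ip]
        by (simp add: Up differential_chart[OF b d u])
      then show ?thesis
        unfolding cov_deriv_along_chart[OF b d u V'd] expand[OF p ip d]
        by (simp add: linear_sum[OF lin] linear_scale[OF lin] sum.distrib scaleR_right_distrib)
    qed
  qed
  have s1: "(\<lambda>d. \<Sum>j\<in>Basis. (V' (u b) \<bullet> j) *\<^sub>R X j (i p) d) \<in> tangent_space A (i p)"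
    by (rule tangent_space_sum[OF c tX])
  have s2: "(\<lambda>d. \<Sum>j\<in>Basis. (V p c \<bullet> j) *\<^sub>R cov_deriv A \<Gamma> U (X j) (i p) d) \<in> tangent_space A (i p)"
    by (rule tangent_space_sum[OF c smooth_vector_field_on_tangent[OF smooth_cov_deriv[OF sU sX] ip]])
  show ?thesis unfolding eq by (rule tangent_space_linear_combination[OF c s1 s2])
qed

text \<open>In the product rule, the derivative of the metric coefficients along \<open>i\<close>
  supplies exactly the Christoffel terms that complete \<open>V'\<close> and \<open>W'\<close> to
  covariant derivatives. Keeping \<open>f\<close> separate admits functions that coincide with the
  ambient product over the chart, such as the rigged product with \<xi>.\<close>

lemma dir_deriv_metric_along:
  assumes b: "b \<in> charts_at B p" and c: "c \<in> charts_at A (i p)" and u: "u \<in> tangent_space B p"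
    and V: "field_along b c p V V'" and W: "field_along b c p W W'"
    and f: "\<And>q. q \<in> fst b \<Longrightarrow> f q = g (i q) (V q) (W q)"
  shows "dir_deriv B p u f =
    g (i p) (cov_deriv_along B A i \<Gamma> p u V) (W p) + g (i p) (V p) (cov_deriv_along B A i \<Gamma> p u W)"
proof -
  have cA: "c \<in> A" and ip: "i p \<in> fst c" and bB: "b \<in> B" and p: "p \<in> fst b"
    using b c by (auto simp: charts_at_iff)
  have Vt: "V q \<in> tangent_space A (i q)" and Wt: "W q \<in> tangent_space A (i q)" if "q \<in> fst b" for q
    using V W that by (auto simp: field_along_def)
  define G where "G x = coord_metric c (i (chart_inv b x))" for x
  define D where "D = differential_rep b c p"
  define G' where "G' v w = (\<lambda>a. coord_metric c (i p) (\<Gamma> c (i p) (D a) v) w +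
    coord_metric c (i p) v (\<Gamma> c (i p) (D a) w))" for v w
  have G': "((\<lambda>x. G x v w) has_derivative G' v w) (at (snd b p))" for v w
    using has_derivative_along[OF b c, where f = "\<lambda>q. coord_metric c q v w"]
      coord_metric_has_derivative[OF c, of v w]
    by (simp add: o_def G_def G'_def D_def)
  have "((\<lambda>x. G x (((\<lambda>q. V q c) \<circ> chart_inv b) x) (((\<lambda>q. W q c) \<circ> chart_inv b) x)) has_derivative
     (\<lambda>a. G' (((\<lambda>q. V q c) \<circ> chart_inv b) (snd b p)) (((\<lambda>q. W q c) \<circ> chart_inv b) (snd b p)) a +
       G (snd b p) (V' a) (((\<lambda>q. W q c) \<circ> chart_inv b) (snd b p)) +
       G (snd b p) (((\<lambda>q. V q c) \<circ> chart_inv b) (snd b p)) (W' a))) (at (snd b p))"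
  proof (rule has_derivative_bilinear_family[OF open_map_dom[OF bB cA] in_map_dom[OF b c] _ G'])
    show "bilinear (G x)" if "x \<in> map_dom b c" for x
      unfolding G_def by (rule bilinear_coord_metric) (use that bB cA in \<open>auto simp: charts_at_iff\<close>)
  qed (use V W in \<open>simp_all add: field_along_def o_def\<close>)
  then have "((\<lambda>x. G x (V (chart_inv b x) c) (W (chart_inv b x) c)) has_derivative
     (\<lambda>a. G' (V p c) (W p c) a + G (snd b p) (V' a) (W p c) + G (snd b p) (V p c) (W' a))) (at (snd b p))"
    using bB p by (simp add: o_def)
  then have "((\<lambda>x. G x (V (chart_inv b x) c) (W (chart_inv b x) c)) has_derivative
     (\<lambda>a. coord_metric c (i p) (V' a + \<Gamma> c (i p) (D a) (V p c)) (W p c) +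
       coord_metric c (i p) (V p c) (W' a + \<Gamma> c (i p) (D a) (W p c)))) (at (snd b p))"
    by (rule has_derivative_eq_rhs)
      (use bilinear_coord_metric[OF c] bB p in
        \<open>auto simp: G_def G'_def fun_eq_iff bilinear_ladd bilinear_radd\<close>)
  then have "((f \<circ> chart_inv b) has_derivative
     (\<lambda>a. coord_metric c (i p) (V' a + \<Gamma> c (i p) (D a) (V p c)) (W p c) +
       coord_metric c (i p) (V p c) (W' a + \<Gamma> c (i p) (D a) (W p c)))) (at (snd b p))"
    by (rule has_derivative_transform_within_open[OF _ open_map_dom[OF bB cA] in_map_dom[OF b c]])
      (use bB cA in \<open>auto simp: f G_def metric_coord[of c] Vt Wt charts_at_iff\<close>)
  from source.dir_deriv_chart[OF b u this] show ?thesis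
    by (simp add: metric_coord[OF c] Vt Wt p cov_deriv_along_in_tangent_space[OF b c u V]
        cov_deriv_along_in_tangent_space[OF b c u W] cov_deriv_along_chart[OF b c u V]
        cov_deriv_along_chart[OF b c u W] D_def)
qed

lemma dir_deriv_const_on_chart:
  assumes b: "b \<in> charts_at B p" and u: "u \<in> tangent_space B p" and f: "\<And>q. q \<in> fst b \<Longrightarrow> f q = k"
  shows "dir_deriv B p u f = 0"
proof -
  have "((f \<circ> chart_inv b) has_derivative (\<lambda>_. 0)) (at (snd b p))"
    by (rule has_derivative_transform_within_open[OF has_derivative_const[of k], where s = "snd b ` fst b"])
      (use b f source.open_chart_range in \<open>auto simp: charts_at_iff\<close>)
  from source.dir_deriv_chart[OF b u this] show ?thesis by simp
qed

text \<open>The product rule for the differential of \<open>i\<close> applied to \<open>X\<close>.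
  The second derivative of \<open>i\<close> is displayed because \<open>torsion_free_along\<close>
  exchanges its two directions.\<close>

lemma field_along_differential:
  assumes b: "b \<in> charts_at B p" and c: "c \<in> charts_at A (i p)"
    and X: "smooth_vector_field_on B T X" and T: "fst b \<subseteq> T"
    and X': "(((\<lambda>q. X q b) \<circ> chart_inv b) has_derivative X') (at (snd b p))"
  shows "field_along b c p (\<lambda>q. differential B A i q (X q))
    (\<lambda>u. frechet_derivative (\<lambda>y. frechet_derivative (map_rep b c) (at y) (X p b)) (at (snd b p)) u +
      differential_rep b c p (X' u))"
  unfolding field_along_def
proof
  have bB: "b \<in> B" and cA: "c \<in> A" and p: "p \<in> fst b" using b c by (auto simp: charts_at_iff)
  have Xt: "X q \<in> tangent_space B q" if "q \<in> fst b" for q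
    using smooth_vector_field_on_tangent[OF X] that T by blast
  show "\<forall>q\<in>fst b. differential B A i q (X q) \<in> tangent_space A (i q)"
    using Xt bB by (auto intro!: differential_in_tangent_space simp: carrier_of_def)
  let ?F = "map_rep b c"
  note sm = smooth_map_rep[OF bB cA]
  have "((\<lambda>y. frechet_derivative ?F (at y) (((\<lambda>q. X q b) \<circ> chart_inv b) y)) has_derivative
    (\<lambda>u. frechet_derivative (\<lambda>y. frechet_derivative ?F (at y) (((\<lambda>q. X q b) \<circ> chart_inv b) (snd b p))) (at (snd b p)) u +
      frechet_derivative ?F (at (snd b p)) (X' u))) (at (snd b p))"
  proof (rule has_derivative_linear_family[OF open_map_dom[OF bB cA] in_map_dom[OF b c] _ _ X'])
    show "linear (frechet_derivative ?F (at y))" if "y \<in> map_dom b c" for y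
      using smooth_on_has_derivative[OF sm that] has_derivative_linear by blast
    show "((\<lambda>y. frechet_derivative ?F (at y) v) has_derivative
      frechet_derivative (\<lambda>y. frechet_derivative ?F (at y) v) (at (snd b p))) (at (snd b p))" for v
      by (rule smooth_on_has_derivative[OF smooth_on_deriv[OF sm] in_map_dom[OF b c]])
  qed
  then have "(((\<lambda>q. differential B A i q (X q) c) \<circ> chart_inv b) has_derivative
    (\<lambda>u. frechet_derivative (\<lambda>y. frechet_derivative ?F (at y) (((\<lambda>q. X q b) \<circ> chart_inv b) (snd b p))) (at (snd b p)) u +
      frechet_derivative ?F (at (snd b p)) (X' u))) (at (snd b p))"
  proof (rule has_derivative_transform_within_open[OF _ open_map_dom[OF bB cA] in_map_dom[OF b c]])
    fix y assume "y \<in> map_dom b c"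
    then obtain q where q: "q \<in> fst b" "i q \<in> fst c" "y = snd b q" by blast
    have "b \<in> charts_at B q" "c \<in> charts_at A (i q)" using q bB cA by (auto simp: charts_at_iff)
    from differential_chart[OF this Xt[OF q(1)]]
    show "frechet_derivative ?F (at y) (((\<lambda>q. X q b) \<circ> chart_inv b) y) =
        ((\<lambda>q. differential B A i q (X q) c) \<circ> chart_inv b) y"
      using q bB by simp
  qed
  then show "(((\<lambda>q. differential B A i q (X q) c) \<circ> chart_inv b) has_derivative
    (\<lambda>u. frechet_derivative (\<lambda>y. frechet_derivative ?F (at y) (X p b)) (at (snd b p)) u +
      differential_rep b c p (X' u))) (at (snd b p))"
    using bB p by simp
qed

lemma field_along_restriction:
  assumes b: "b \<in> charts_at B p" and c: "c \<in> charts_at A (i p)"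
    and Z: "smooth_vector_field_on A T Z" and T: "i ` carrier_of B \<subseteq> T"
    and Z': "(((\<lambda>q. Z q c) \<circ> chart_inv c) has_derivative Z') (at (snd c (i p)))"
  shows "field_along b c p (\<lambda>q. Z (i q)) (Z' \<circ> differential_rep b c p)"
  unfolding field_along_def
proof
  show "\<forall>q\<in>fst b. Z (i q) \<in> tangent_space A (i q)"
    using smooth_vector_field_on_tangent[OF Z] T b by (force simp: carrier_of_def charts_at_iff)
  show "(((\<lambda>q. Z (i q) c) \<circ> chart_inv b) has_derivative (Z' \<circ> differential_rep b c p)) (at (snd b p))"
    using has_derivative_along[OF b c Z'] by (simp add: o_def)
qed

text \<open>The second derivatives of \<open>i\<close> in the two sides agree by symmetry, the Christoffel terms by symmetry of \<open>\<Gamma>\<close>.\<close>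

lemma torsion_free_along:
  assumes b: "b \<in> charts_at B p" and c: "c \<in> charts_at A (i p)"
    and X: "smooth_vector_field_on B T X" and Y: "smooth_vector_field_on B T Y" and T: "fst b \<subseteq> T"
    and lb: "lie_bracket B X Y p \<in> tangent_space B p"
  shows "cov_deriv_along B A i \<Gamma> p (X p) (\<lambda>q. differential B A i q (Y q)) =
    (\<lambda>d. cov_deriv_along B A i \<Gamma> p (Y p) (\<lambda>q. differential B A i q (X q)) d +
      differential B A i p (lie_bracket B X Y p) d)"
proof -
  have bB: "b \<in> B" and cA: "c \<in> A" and p: "p \<in> fst b" using b c by (auto simp: charts_at_iff)
  then have pT: "p \<in> T" and pc: "p \<in> carrier_of B" using T by (auto simp: carrier_of_def)
  note X' = source.smooth_vector_field_on_has_derivative[OF X pT b]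
  note Y' = source.smooth_vector_field_on_has_derivative[OF Y pT b]
  note Xt = smooth_vector_field_on_tangent[OF X pT] and Yt = smooth_vector_field_on_tangent[OF Y pT]
  note FX = field_along_differential[OF b c X T X'] and FY = field_along_differential[OF b c Y T Y']
  show ?thesis
  proof (rule tangent_space_eqI[OF _ _ c])
    show "cov_deriv_along B A i \<Gamma> p (X p) (\<lambda>q. differential B A i q (Y q)) \<in> tangent_space A (i p)"
      by (rule cov_deriv_along_in_tangent_space[OF b c Xt FY])
    \<comment> \<open>Tangency of both sides reduces the identity to the one chart \<open>c\<close>.
      For the bracket it is the assumption \<open>lb\<close>, later supplied by the rigged
      connection.\<close>
    show "(\<lambda>d. cov_deriv_along B A i \<Gamma> p (Y p) (\<lambda>q. differential B A i q (X q)) d +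
      differential B A i p (lie_bracket B X Y p) d) \<in> tangent_space A (i p)"
      using tangent_space_linear_combination[OF c cov_deriv_along_in_tangent_space[OF b c Yt FX]
          differential_in_tangent_space[OF lb pc], of 1] by simp
    show "cov_deriv_along B A i \<Gamma> p (X p) (\<lambda>q. differential B A i q (Y q)) c =
      cov_deriv_along B A i \<Gamma> p (Y p) (\<lambda>q. differential B A i q (X q)) c +
      differential B A i p (lie_bracket B X Y p) c"
      unfolding cov_deriv_along_chart[OF b c Xt FY] cov_deriv_along_chart[OF b c Yt FX]
        differential_chart[OF b c lb] differential_chart[OF b c Xt] differential_chart[OF b c Yt]
        source.lie_bracket_chart[of b p X Y, OF b Xt Yt Y' X'] linear_diff[OF linear_differential_rep[OF b c]]
        symmetric_second_derivative[OF open_map_dom[OF bB cA] smooth_map_rep[OF bB cA] in_map_dom[OF b c], of "Y p b" "X p b"]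
        christoffel_sym[OF c, of "differential_rep b c p (X p b)"]
      by simp
  qed
qed

text \<open>The derivative of \<open>Z\<close> along \<open>i\<close> has the coordinates that occur
  in \<open>conformal_field_coord\<close> at pushed forward vectors, so the ambient identity
  restricts to L.\<close>

lemma conformal_field_along:
  assumes b: "b \<in> charts_at B p" and c: "c \<in> charts_at A (i p)"
    and Z: "smooth_vector_field_on A T Z" and T: "i ` carrier_of B \<subseteq> T"
    and conf: "conformal_field_on A g T Z"
  obtains \<sigma> where "\<And>u v. u \<in> tangent_space B p \<Longrightarrow> v \<in> tangent_space B p \<Longrightarrow>
    g (i p) (cov_deriv_along B A i \<Gamma> p u (\<lambda>q. Z (i q))) (differential B A i p v) +
    g (i p) (differential B A i p u) (cov_deriv_along B A i \<Gamma> p v (\<lambda>q. Z (i q))) =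
    2 * \<sigma> * g (i p) (differential B A i p u) (differential B A i p v)"
proof -
  have p: "p \<in> carrier_of B" using b by (auto simp: charts_at_iff carrier_of_def)
  then have ip: "i p \<in> T" using T by blast
  note Z' = smooth_vector_field_on_has_derivative[OF Z ip c]
  note FZ = field_along_restriction[OF b c Z T Z']
  obtain \<sigma> where \<sigma>: "\<And>u v. coord_metric c (i p)
      (frechet_derivative ((\<lambda>q. Z q c) \<circ> chart_inv c) (at (snd c (i p))) u + \<Gamma> c (i p) u (Z (i p) c)) v +
    coord_metric c (i p) u
      (frechet_derivative ((\<lambda>q. Z q c) \<circ> chart_inv c) (at (snd c (i p))) v + \<Gamma> c (i p) v (Z (i p) c)) =
    2 * \<sigma> * coord_metric c (i p) u v"
    using conformal_field_coord[OF conf Z ip c Z'] by metis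
  show thesis
    by (rule that[of \<sigma>])
      (use \<sigma> in \<open>simp add: metric_coord[OF c] cov_deriv_along_in_tangent_space[OF b c _ FZ] p
        differential_in_tangent_space cov_deriv_along_chart[OF b c _ FZ] differential_chart[OF b c]\<close>)
qed

end

section \<open>Null hypersurfaces with a rigging\<close>

locale null_rigging = immersion A g \<Gamma> B i
  for A :: "('m::{t2_space, second_countable_topology}, 'e::euclidean_space) chart set"
    and g :: "('m, 'e) metric" and \<Gamma> :: "('m, 'e) christoffel"
    and B :: "('n::{t2_space, second_countable_topology}, 'l::euclidean_space) chart set"
    and i :: "'n \<Rightarrow> 'm" +
  fixes U :: "'m set" and \<zeta> :: "'m \<Rightarrow> ('m, 'e) tvec" and \<xi> :: "'n \<Rightarrow> ('n, 'l) tvec"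
  assumes lorentzian: "lorentzian_metric A g"
    and null_hypersurface: "null_hypersurface B A i g"
    and rigging: "rigging B A i U \<zeta>"
    and rigged: "rigged_vector_field B A i g \<zeta> \<xi>"
begin

abbreviation d_along where "d_along p u V \<equiv> cov_deriv_along B A i \<Gamma> p u V"

abbreviation push where "push q v \<equiv> differential B A i q v"

abbreviation \<xi>_along where "\<xi>_along \<equiv> \<lambda>q. push q (\<xi> q)"

lemma smooth_rigging: "smooth_vector_field_on A U \<zeta>"
  and image_subset_U: "i ` carrier_of B \<subseteq> U"
  and rigging_transversal: "p \<in> carrier_of B \<Longrightarrow> \<zeta> (i p) \<notin> push p ` tangent_space B p"
  using rigging by (auto simp: rigging_def)

lemma rigging_in_tangent_space: "p \<in> carrier_of B \<Longrightarrow> \<zeta> (i p) \<in> tangent_space A (i p)"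
  using smooth_vector_field_on_tangent[OF smooth_rigging] image_subset_U by blast

lemma smooth_rigged: "smooth_vector_field_on B (carrier_of B) \<xi>"
  using rigged by (simp add: rigged_vector_field_def)

lemma rigged_in_tangent_space: "p \<in> carrier_of B \<Longrightarrow> \<xi> p \<in> tangent_space B p"
  by (rule smooth_vector_field_on_tangent[OF smooth_rigged])

lemma rigged_metric_\<xi>:
  "p \<in> carrier_of B \<Longrightarrow> v \<in> tangent_space B p \<Longrightarrow>
    rigged_metric B A i g \<zeta> p (\<xi> p) v = g (i p) (\<zeta> (i p)) (push p v)"
  using rigged by (simp add: rigged_vector_field_def rigging_form_def)

lemma inj_push: "p \<in> carrier_of B \<Longrightarrow> inj_on (push p) (tangent_space B p)"
  using null_hypersurface by (simp add: null_hypersurface_def hypersurface_def)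

text \<open>A dimension count in the chart \<open>c\<close>: the image of the injective differential
  has codimension one, and the transversal \<zeta> fills the gap.\<close>

lemma tangent_space_decomposition:
  assumes p: "p \<in> carrier_of B" and a: "a \<in> tangent_space A (i p)"
  obtains w t where "w \<in> tangent_space B p" "a = (\<lambda>d. t *\<^sub>R \<zeta> (i p) d + push p w d)"
proof -
  obtain b c where b: "b \<in> charts_at B p" and c: "c \<in> charts_at A (i p)" using carrier_charts[OF p] .
  let ?F = "differential_rep b c p"
  have F: "linear ?F" by (rule linear_differential_rep[OF b c])
  note tv = source.tvec_of_in_tangent_space[OF b]
  have Ft: "push p (tvec_of B b p u) c = ?F u" for u
    using differential_chart[OF b c tv, of u] b by simp
  have "inj ?F"
  proof (rule injI)
    fix u v assume uv: "?F u = ?F v"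
    have "push p (tvec_of B b p u) = push p (tvec_of B b p v)"
      by (rule tangent_space_eqI[OF differential_in_tangent_space[OF tv p]
            differential_in_tangent_space[OF tv p] c]) (simp only: Ft uv)
    then have "tvec_of B b p u = tvec_of B b p v"
      by (rule inj_onD[OF inj_push[OF p] _ tv tv])
    from fun_cong[OF this, of b] show "u = v" by (simp only: source.tvec_of_chart[OF b])
  qed
  then have dimF: "dim (range ?F) = DIM('l)"
    using dim_image_eq[OF F, of UNIV] by simp
  have sub: "span (range ?F) = range ?F"
    using F by (simp add: linear_subspace_image)
  have "\<zeta> (i p) c \<notin> range ?F"
  proof
    assume "\<zeta> (i p) c \<in> range ?F"
    then obtain u where "\<zeta> (i p) c = push p (tvec_of B b p u) c" using Ft by auto
    then have "\<zeta> (i p) = push p (tvec_of B b p u)"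
      by (rule tangent_space_eqI[OF rigging_in_tangent_space[OF p] differential_in_tangent_space[OF tv p] c])
    then show False using rigging_transversal[OF p] tv by blast
  qed
  then have "dim (insert (\<zeta> (i p) c) (range ?F)) = DIM('e)"
    using null_hypersurface by (simp add: dim_insert sub dimF null_hypersurface_def hypersurface_def)
  then have "a c \<in> span (insert (\<zeta> (i p) c) (range ?F))" by (simp add: dim_eq_full)
  then obtain t u where tu: "a c - t *\<^sub>R \<zeta> (i p) c = ?F u"
    using span_breakdown_eq[of "a c"] sub by auto
  show thesis
  proof (rule that[OF tv])
    show "a = (\<lambda>d. t *\<^sub>R \<zeta> (i p) d + push p (tvec_of B b p u) d)"
      by (rule tangent_space_eqI[OF a tangent_space_linear_combination[OF c
              rigging_in_tangent_space[OF p] differential_in_tangent_space[OF tv p]] c])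
        (simp add: Ft tu[symmetric])
  qed
qed

text \<open>The tangent space of L and \<zeta> span the ambient tangent space, so orthogonality need
  only be tested on them.\<close>

lemma nondegenerate:
  assumes p: "p \<in> carrier_of B" and a: "a \<in> tangent_space A (i p)"
    and orth: "\<And>v. v \<in> tangent_space B p \<Longrightarrow> g (i p) a (push p v) = 0"
    and orth': "g (i p) a (\<zeta> (i p)) = 0"
  shows "a = (\<lambda>_. 0)"
proof -
  obtain b c where b: "b \<in> charts_at B p" and c: "c \<in> charts_at A (i p)" using carrier_charts[OF p] .
  show ?thesis
  proof (rule lorentzian_nondegenerate[OF lorentzian c a])
    fix v assume "v \<in> tangent_space A (i p)"
    then obtain w t where w: "w \<in> tangent_space B p" and v: "v = (\<lambda>d. t *\<^sub>R \<zeta> (i p) d + push p w d)"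
      using tangent_space_decomposition[OF p] by metis
    show "g (i p) a v = 0"
      unfolding v by (simp add: metric_linear_right[OF c rigging_in_tangent_space[OF p]
            differential_in_tangent_space[OF w p] a] orth[OF w] orth')
  qed
qed

lemma push_zero:
  assumes p: "p \<in> carrier_of B"
  shows "push p (\<lambda>_. 0) = (\<lambda>_. 0)"
proof -
  obtain b where b: "b \<in> charts_at B p" using carrier_charts[OF p] .
  note z = source.zero_in_tangent_space[OF b]
  \<comment> \<open>The scalar -1 makes the two images of zero cancel.\<close>
  show ?thesis using differential_linear_combination[OF z z p, of "-1"] by simp
qed

text \<open>
  Pairing \<open>\<xi>\<close> with a vector \<open>u\<close> in the radical of \<open>i\<^sup>*g\<close> gives \<open>\<omega>(\<xi>) \<omega>(u) = \<omega>(u)\<close>, and \<open>\<omega>(u) \<noteq> 0\<close>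
  because \<open>g\<close> is nondegenerate.
\<close>

lemma
  assumes p: "p \<in> carrier_of B"
  shows rigging_\<xi>: "g (i p) (\<zeta> (i p)) (push p (\<xi> p)) = 1"
    and \<xi>_null: "v \<in> tangent_space B p \<Longrightarrow> g (i p) (push p (\<xi> p)) (push p v) = 0"
proof -
  let ?\<omega> = "\<lambda>v. g (i p) (\<zeta> (i p)) (push p v)"
  note \<xi> = rigged_in_tangent_space[OF p]
  have ip: "i p \<in> carrier_of A" by (rule carrier_image[OF p])
  have eq: "g (i p) (push p (\<xi> p)) (push p v) + ?\<omega> (\<xi> p) * ?\<omega> v = ?\<omega> v" if "v \<in> tangent_space B p" for v
    using rigged_metric_\<xi>[OF p that] by (simp add: rigged_metric_def pullback_metric_def rigging_form_def)
  obtain u where u: "u \<in> tangent_space B p" "u \<noteq> (\<lambda>_. 0)"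
    "\<And>v. v \<in> tangent_space B p \<Longrightarrow> g (i p) (push p u) (push p v) = 0"
    using null_hypersurface p unfolding null_hypersurface_def pullback_metric_def by blast
  note du = differential_in_tangent_space[OF u(1) p]
  \<comment> \<open>Otherwise the image of \<open>u\<close> would be orthogonal to \<zeta> as well
    as to L, hence zero, against injectivity of the differential.\<close>
  have "?\<omega> u \<noteq> 0"
  proof
    assume "?\<omega> u = 0"
    then have "push p u = (\<lambda>_. 0)"
      using metric_sym[OF ip du rigging_in_tangent_space[OF p]] by (intro nondegenerate[OF p du u(3)]) auto
    moreover obtain b where "b \<in> charts_at B p" using carrier_charts[OF p] .
    ultimately have "u = (\<lambda>_. 0)"
      using inj_onD[OF inj_push[OF p] _ u(1) source.zero_in_tangent_space] push_zero[OF p] by simp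
    then show False using u(2) by simp
  qed
  moreover have "g (i p) (push p (\<xi> p)) (push p u) = 0"
    using u(3)[OF \<xi>] metric_sym[OF ip du differential_in_tangent_space[OF \<xi> p]] by simp
  ultimately show 1: "?\<omega> (\<xi> p) = 1" using eq[OF u(1)] by simp
  show "g (i p) (push p (\<xi> p)) (push p v) = 0" if "v \<in> tangent_space B p" using eq[OF that] 1 by simp
qed

text \<open>Pairing with \<xi> reads off the \<zeta>-component, since g(\<zeta>,\<xi>) = 1 and \<xi>
  is orthogonal to L.\<close>

lemma orthogonal_\<xi>_tangent:
  assumes p: "p \<in> carrier_of B" and a: "a \<in> tangent_space A (i p)"
    and orth: "g (i p) (push p (\<xi> p)) a = 0"
  obtains w where "w \<in> tangent_space B p" "a = push p w"
proof -
  obtain b c where b: "b \<in> charts_at B p" and c: "c \<in> charts_at A (i p)" using carrier_charts[OF p] .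
  obtain w t where w: "w \<in> tangent_space B p" and v: "a = (\<lambda>d. t *\<^sub>R \<zeta> (i p) d + push p w d)"
    using tangent_space_decomposition[OF p a] .
  note \<zeta> = rigging_in_tangent_space[OF p]
  note \<xi> = rigged_in_tangent_space[OF p]
  have "t * g (i p) (push p (\<xi> p)) (\<zeta> (i p)) = 0"
    using orth unfolding v
    by (simp add: metric_linear_right[OF c \<zeta> differential_in_tangent_space[OF w p]
          differential_in_tangent_space[OF \<xi> p]] \<xi>_null[OF p w])
  then have "t = 0"
    using rigging_\<xi>[OF p] metric_sym[OF carrier_image[OF p] differential_in_tangent_space[OF \<xi> p] \<zeta>] by simp
  then show thesis using that[OF w] v by simp
qed

lemma ambient_deriv_\<xi>: "ambient_deriv B A i \<Gamma> \<xi> p u = d_along p u \<xi>_along"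
  by (simp add: ambient_deriv_def)

lemma field_along_\<xi>:
  assumes b: "b \<in> charts_at B p" and c: "c \<in> charts_at A (i p)"
  obtains V' where "field_along b c p \<xi>_along V'"
proof -
  have "p \<in> carrier_of B" "fst b \<subseteq> carrier_of B" using b by (auto simp: charts_at_iff carrier_of_def)
  then show thesis
    using field_along_differential[OF b c smooth_rigged _
        source.smooth_vector_field_on_has_derivative[OF smooth_rigged _ b]] that by blast
qed

lemma field_along_rigging:
  assumes b: "b \<in> charts_at B p" and c: "c \<in> charts_at A (i p)"
  obtains V' where "field_along b c p (\<lambda>q. \<zeta> (i q)) V'"
proof -
  have "i p \<in> U" using b image_subset_U by (auto simp: charts_at_iff carrier_of_def)
  then show thesis
    using field_along_restriction[OF b c smooth_rigging image_subset_U
        smooth_vector_field_on_has_derivative[OF smooth_rigging _ c]] that by blast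
qed

text \<open>The last two identities come from differentiating the constants g(\<xi>,\<xi>) = 0 and
  g(\<zeta>,\<xi>) = 1 along \<open>u\<close>.\<close>

lemma
  assumes p: "p \<in> carrier_of B" and u: "u \<in> tangent_space B p"
  shows d_along_\<xi>_in_tangent_space: "d_along p u \<xi>_along \<in> tangent_space A (i p)"
    and d_along_rigging_in_tangent_space: "d_along p u (\<lambda>q. \<zeta> (i q)) \<in> tangent_space A (i p)"
    and metric_d_along_\<xi>: "g (i p) (push p (\<xi> p)) (d_along p u \<xi>_along) = 0"
    and metric_d_along_rigging: "g (i p) (\<zeta> (i p)) (d_along p u \<xi>_along) =
      - g (i p) (push p (\<xi> p)) (d_along p u (\<lambda>q. \<zeta> (i q)))"
proof -
  obtain b c where b: "b \<in> charts_at B p" and c: "c \<in> charts_at A (i p)" using carrier_charts[OF p] .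
  have ip: "i p \<in> carrier_of A" by (rule carrier_image[OF p])
  note \<xi> = differential_in_tangent_space[OF rigged_in_tangent_space[OF p] p]
  have q: "q \<in> carrier_of B" if "q \<in> fst b" for q
    using b that by (auto simp: charts_at_iff carrier_of_def)
  obtain V' where V': "field_along b c p \<xi>_along V'" using field_along_\<xi>[OF b c] .
  obtain Z' where Z': "field_along b c p (\<lambda>q. \<zeta> (i q)) Z'" using field_along_rigging[OF b c] .
  show t: "d_along p u \<xi>_along \<in> tangent_space A (i p)"
    by (rule cov_deriv_along_in_tangent_space[OF b c u V'])
  show tz: "d_along p u (\<lambda>q. \<zeta> (i q)) \<in> tangent_space A (i p)"
    by (rule cov_deriv_along_in_tangent_space[OF b c u Z'])
  have "g (i p) (d_along p u \<xi>_along) (push p (\<xi> p)) + g (i p) (push p (\<xi> p)) (d_along p u \<xi>_along) = 0"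
    unfolding dir_deriv_metric_along[OF b c u V' V' refl, symmetric]
    by (rule dir_deriv_const_on_chart[OF b u]) (simp add: q \<xi>_null rigged_in_tangent_space)
  then show "g (i p) (push p (\<xi> p)) (d_along p u \<xi>_along) = 0"
    using metric_sym[OF ip t \<xi>] by simp
  have "g (i p) (d_along p u (\<lambda>q. \<zeta> (i q))) (push p (\<xi> p)) + g (i p) (\<zeta> (i p)) (d_along p u \<xi>_along) = 0"
    unfolding dir_deriv_metric_along[OF b c u Z' V' refl, symmetric]
    by (rule dir_deriv_const_on_chart[OF b u]) (simp add: q rigging_\<xi>)
  then show "g (i p) (\<zeta> (i p)) (d_along p u \<xi>_along) =
      - g (i p) (push p (\<xi> p)) (d_along p u (\<lambda>q. \<zeta> (i q)))"
    using metric_sym[OF ip tz \<xi>] by simp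
qed

text \<open>The derivative of \<xi> is orthogonal to \<xi>, hence tangent to L, so a splitting
  exists. Pairing with \<zeta> kills the screen part and fixes the coefficient of \<xi>, which
  discharges \<open>THE\<close>.\<close>

lemma rotation_form_eq:
  assumes p: "p \<in> carrier_of B" and u: "u \<in> tangent_space B p"
  shows "rotation_form B A i g \<Gamma> \<zeta> \<xi> p u = - g (i p) (\<zeta> (i p)) (d_along p u \<xi>_along)"
proof -
  obtain b c where b: "b \<in> charts_at B p" and c: "c \<in> charts_at A (i p)" using carrier_charts[OF p] .
  note \<xi> = rigged_in_tangent_space[OF p]
  note d\<xi> = differential_in_tangent_space[OF \<xi> p]
  note \<zeta> = rigging_in_tangent_space[OF p]
  let ?\<omega> = "\<lambda>a. g (i p) (\<zeta> (i p)) a"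
  let ?D = "d_along p u \<xi>_along"
  obtain w where w: "w \<in> tangent_space B p" "?D = push p w"
    using orthogonal_\<xi>_tangent[OF p d_along_\<xi>_in_tangent_space[OF p u] metric_d_along_\<xi>[OF p u]] .
  note dw = differential_in_tangent_space[OF w(1) p]
  have nw: "(\<lambda>d. - w d) \<in> tangent_space B p" "push p (\<lambda>d. - w d) = (\<lambda>d. - push p w d)"
    using source.tangent_space_linear_combination[OF b w(1) source.zero_in_tangent_space[OF b], of "-1"]
      differential_linear_combination[OF w(1) source.zero_in_tangent_space[OF b] p, of "-1"] push_zero[OF p]
    by simp_all
  have ndw: "(\<lambda>d. - push p w d) \<in> tangent_space A (i p)"
    using differential_in_tangent_space[OF nw(1) p] nw(2) by simp
  \<comment> \<open>This is the screen part A*(u). The multiple of \<xi> cancels the \<omega>-value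
    of - w, because \<omega>(\<xi>) = 1 and \<open>w\<close> maps to \<open>?D\<close>.\<close>
  define a where "a = (\<lambda>d. ?\<omega> ?D *\<^sub>R \<xi> p d + - w d)"
  have a: "a \<in> tangent_space B p" and pa: "push p a = (\<lambda>d. ?\<omega> ?D *\<^sub>R push p (\<xi> p) d + - ?D d)"
    unfolding a_def
    using source.tangent_space_linear_combination[OF b \<xi> nw(1)] differential_linear_combination[OF \<xi> nw(1) p]
    by (auto simp: nw w(2))
  have "?\<omega> (\<lambda>d. - ?D d) = - ?\<omega> ?D"
    using metric_linear_right[OF c dw zero_in_tangent_space[OF c] \<zeta>, of "-1"]
      metric_linear_right[OF c zero_in_tangent_space[OF c] zero_in_tangent_space[OF c] \<zeta>, of 1]
    by (simp add: w(2))
  then have "?\<omega> (push p a) = 0"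
    unfolding pa using metric_linear_right[OF c d\<xi> ndw \<zeta>, of "?\<omega> ?D"] rigging_\<xi>[OF p] by (simp add: w(2))
  then have "a \<in> screen B A i g \<zeta> p" using a by (simp add: screen_def)
  moreover have "?D = (\<lambda>d. - (- ?\<omega> ?D) *\<^sub>R push p (\<xi> p) d - push p a d)"
    unfolding pa by simp
  moreover have "t = - ?\<omega> ?D" if "a' \<in> screen B A i g \<zeta> p"
    "?D = (\<lambda>d. - t *\<^sub>R push p (\<xi> p) d - push p a' d)" for t a'
  proof -
    have a': "a' \<in> tangent_space B p" "?\<omega> (push p a') = 0" using that(1) by (auto simp: screen_def)
    have "push p a' = (\<lambda>d. (- t) *\<^sub>R push p (\<xi> p) d + - ?D d)"
      unfolding that(2) by simp
    then have "?\<omega> (push p a') = - t * 1 + - ?\<omega> ?D"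
      using metric_linear_right[OF c d\<xi> ndw \<zeta>, of "- t"] rigging_\<xi>[OF p]
        \<open>?\<omega> (\<lambda>d. - ?D d) = - ?\<omega> ?D\<close> by (simp add: w(2))
    then show ?thesis using a'(2) by simp
  qed
  ultimately show ?thesis
    unfolding rotation_form_def ambient_deriv_\<xi> by (intro the_equality) blast+
qed

end

section \<open>Consequences of conformality\<close>

locale conformal_null_rigging = null_rigging A g \<Gamma> B i U \<zeta> \<xi> +
    induced: connection_atlas B "rigged_metric B A i g \<zeta>" \<Gamma>'
  for A :: "('m::{t2_space, second_countable_topology}, 'e::euclidean_space) chart set"
    and g :: "('m, 'e) metric" and \<Gamma> :: "('m, 'e) christoffel"
    and B :: "('n::{t2_space, second_countable_topology}, 'l::euclidean_space) chart set"
    and i :: "'n \<Rightarrow> 'm" and U :: "'m set" and \<zeta> :: "'m \<Rightarrow> ('m, 'e) tvec"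
    and \<xi> :: "'n \<Rightarrow> ('n, 'l) tvec" and \<Gamma>' :: "('n, 'l) christoffel" +
  assumes conformal: "conformal_field_on A g U \<zeta>"
begin

text \<open>With \<xi> as one argument the term in \<sigma> vanishes, as \<xi> is orthogonal to L.
  So \<nabla>\<zeta> is skew on pairs containing \<xi>, whatever the conformal factor.\<close>

lemma conformal_at_\<xi>:
  assumes p: "p \<in> carrier_of B" and v: "v \<in> tangent_space B p"
  shows "g (i p) (d_along p (\<xi> p) (\<lambda>q. \<zeta> (i q))) (push p v) =
    - g (i p) (push p (\<xi> p)) (d_along p v (\<lambda>q. \<zeta> (i q)))"
proof -
  obtain b c where b: "b \<in> charts_at B p" and c: "c \<in> charts_at A (i p)" using carrier_charts[OF p] .
  obtain \<sigma> where "\<And>u v. u \<in> tangent_space B p \<Longrightarrow> v \<in> tangent_space B p \<Longrightarrow>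
    g (i p) (d_along p u (\<lambda>q. \<zeta> (i q))) (push p v) + g (i p) (push p u) (d_along p v (\<lambda>q. \<zeta> (i q))) =
    2 * \<sigma> * g (i p) (push p u) (push p v)"
    using conformal_field_along[OF b c smooth_rigging image_subset_U conformal] by metis
  from this[OF rigged_in_tangent_space[OF p] v] \<xi>_null[OF p v] show ?thesis by simp
qed

text \<open>Product rule and torsion identity need fields, the claims concern one vector. The
  extension and \<xi> are put on one common chart domain.\<close>

lemma coordinate_extension:
  assumes p: "p \<in> carrier_of B" and x: "x \<in> tangent_space B p"
  obtains b c X where "b \<in> charts_at B p" "c \<in> charts_at A (i p)" "smooth_vector_field_on B (fst b) X"
    "X p = x" "smooth_vector_field_on B (fst b) \<xi>" "p \<in> fst b" "fst b \<subseteq> carrier_of B"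
proof -
  obtain b c where b: "b \<in> charts_at B p" and c: "c \<in> charts_at A (i p)" using carrier_charts[OF p] .
  then have bB: "b \<in> B" and pb: "p \<in> fst b" by (auto simp: charts_at_iff)
  have sub: "fst b \<subseteq> carrier_of B" using bB by (auto simp: carrier_of_def)
  show thesis
    by (rule that[OF b c source.smooth_vector_field_on_tvec_of[OF bB, of "x b"]
          source.tvec_of_coord[OF x b]
          smooth_vector_field_on_subset[OF smooth_rigged source.open_chart[OF bB] sub] pb sub])
qed

lemma d_along_\<xi>_\<xi>:
  assumes p: "p \<in> carrier_of B"
  shows "d_along p (\<xi> p) \<xi>_along = (\<lambda>_. 0)"
proof (rule nondegenerate[OF p])
  note \<xi> = rigged_in_tangent_space[OF p]
  note d\<xi> = differential_in_tangent_space[OF \<xi> p]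
  have ip: "i p \<in> carrier_of A" by (rule carrier_image[OF p])
  note t = d_along_\<xi>_in_tangent_space[OF p \<xi>] and \<zeta> = rigging_in_tangent_space[OF p]
  show "d_along p (\<xi> p) \<xi>_along \<in> tangent_space A (i p)" by (rule t)
  \<comment> \<open>Skewness on the pair (\<xi>,\<xi>): by symmetry of \<open>g\<close> the number
    equals its own negative.\<close>
  have "g (i p) (push p (\<xi> p)) (d_along p (\<xi> p) (\<lambda>q. \<zeta> (i q))) = 0"
    using conformal_at_\<xi>[OF p \<xi>] metric_sym[OF ip d_along_rigging_in_tangent_space[OF p \<xi>] d\<xi>] by simp
  then show "g (i p) (d_along p (\<xi> p) \<xi>_along) (\<zeta> (i p)) = 0"
    using metric_d_along_rigging[OF p \<xi>] metric_sym[OF ip t \<zeta>] by simp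
  fix v assume v: "v \<in> tangent_space B p"
  obtain b c X where b: "b \<in> charts_at B p" and c: "c \<in> charts_at A (i p)"
    and X: "smooth_vector_field_on B (fst b) X" and Xp: "X p = v"
    and s\<xi>: "smooth_vector_field_on B (fst b) \<xi>" and pb: "p \<in> fst b" and sub: "fst b \<subseteq> carrier_of B"
    using coordinate_extension[OF p v] .
  obtain V' where V': "field_along b c p \<xi>_along V'" using field_along_\<xi>[OF b c] .
  note X' = field_along_differential[OF b c X order_refl
      source.smooth_vector_field_on_has_derivative[OF X pb b]]
  note lb = induced.lie_bracket_in_tangent_space[OF s\<xi> X pb b]
  have "g (i p) (d_along p (\<xi> p) \<xi>_along) (push p (X p)) +
      g (i p) (push p (\<xi> p)) (d_along p (\<xi> p) (\<lambda>q. push q (X q))) = 0"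
    unfolding dir_deriv_metric_along[OF b c \<xi> V' X' refl, symmetric]
    by (rule dir_deriv_const_on_chart[OF b \<xi>])
      (use sub smooth_vector_field_on_tangent[OF X] in \<open>auto intro!: \<xi>_null\<close>)
  moreover have "g (i p) (push p (\<xi> p)) (d_along p (\<xi> p) (\<lambda>q. push q (X q))) = 0"
    unfolding torsion_free_along[OF b c s\<xi> X order_refl lb]
    using metric_add_right[OF c d_along_\<xi>_in_tangent_space[OF p v] differential_in_tangent_space[OF lb p] d\<xi>]
      \<xi>_null[OF p lb] metric_d_along_\<xi>[OF p v] by (simp add: Xp)
  ultimately show "g (i p) (d_along p (\<xi> p) \<xi>_along) (push p v) = 0" by (simp add: Xp)
qed

text \<open>
  Both sides equal \<open>d\<omega>(\<xi>,x)\<close>: by the Koszul formula for the rigged metric, in which \<open>\<xi>\<close> has unit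
  length and \<open>\<omega>\<close> is its metric dual, and by conformality of \<open>\<zeta>\<close>, which makes the symmetric part
  of \<open>\<nabla>\<zeta>\<close> vanish on \<open>(\<xi>,x)\<close>.
\<close>

lemma pullback_induced_deriv:
  assumes p: "p \<in> carrier_of B" and x: "x \<in> screen B A i g \<zeta> p"
  shows "pullback_metric B A i g p (cov_deriv B \<Gamma>' \<xi> \<xi> p) x =
    2 * g (i p) (\<zeta> (i p)) (d_along p x \<xi>_along)"
proof -
  let ?h = "rigged_metric B A i g \<zeta>"
  let ?\<omega> = "\<lambda>v. g (i p) (\<zeta> (i p)) (push p v)"
  have xt: "x \<in> tangent_space B p" and x\<omega>: "?\<omega> x = 0" using x by (auto simp: screen_def)
  note \<xi> = rigged_in_tangent_space[OF p] and \<zeta> = rigging_in_tangent_space[OF p]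
  have ip: "i p \<in> carrier_of A" by (rule carrier_image[OF p])
  obtain b c X where b: "b \<in> charts_at B p" and c: "c \<in> charts_at A (i p)"
    and X: "smooth_vector_field_on B (fst b) X" and Xp: "X p = x"
    and s\<xi>: "smooth_vector_field_on B (fst b) \<xi>" and pb: "p \<in> fst b" and sub: "fst b \<subseteq> carrier_of B"
    using coordinate_extension[OF p xt] .
  note K = smooth_vector_field_on_tangent[OF induced.smooth_cov_deriv[OF s\<xi> s\<xi>] pb]
  note \<xi>X = smooth_vector_field_on_tangent[OF induced.smooth_cov_deriv[OF s\<xi> X] pb]
  note X\<xi> = smooth_vector_field_on_tangent[OF induced.smooth_cov_deriv[OF X s\<xi>] pb]
  note lb = induced.lie_bracket_in_tangent_space[OF s\<xi> X pb b]
  obtain Z' where Z': "field_along b c p (\<lambda>q. \<zeta> (i q)) Z'" using field_along_rigging[OF b c] .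
  note X' = field_along_differential[OF b c X order_refl
      source.smooth_vector_field_on_has_derivative[OF X pb b]]
  have h_sym: "?h p v (\<xi> p) = ?h p (\<xi> p) v" if v: "v \<in> tangent_space B p" for v
    using metric_sym[OF ip differential_in_tangent_space[OF v p] differential_in_tangent_space[OF \<xi> p]]
    by (simp add: rigged_metric_def pullback_metric_def)
  \<comment> \<open>The rigged length of \<xi> is constantly 1, so its rigged derivatives are
    orthogonal to \<xi>, which means annihilated by \<omega>.\<close>
  have "2 * ?\<omega> (cov_deriv B \<Gamma>' X \<xi> p) = dir_deriv B p (X p) (\<lambda>q. ?h q (\<xi> q) (\<xi> q))"
    using induced.metric_compatible[OF X s\<xi> s\<xi> pb] rigged_metric_\<xi>[OF p X\<xi>] h_sym[OF X\<xi>] by simp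
  also have "\<dots> = 0"
    using sub by (intro dir_deriv_const_on_chart[OF b, where k = 1])
      (auto simp: Xp xt rigged_metric_\<xi> rigged_in_tangent_space rigging_\<xi> subset_iff)
  finally have 1: "?\<omega> (cov_deriv B \<Gamma>' X \<xi> p) = 0" by simp
  have "cov_deriv B \<Gamma>' \<xi> X p = (\<lambda>d. cov_deriv B \<Gamma>' X \<xi> p d + lie_bracket B \<xi> X p d)"
    unfolding induced.torsion_free[OF s\<xi> X pb, symmetric] by simp
  then have 2: "?\<omega> (cov_deriv B \<Gamma>' \<xi> X p) = ?\<omega> (lie_bracket B \<xi> X p)"
    using metric_add_right[OF c differential_in_tangent_space[OF X\<xi> p] differential_in_tangent_space[OF lb p] \<zeta>]
    by (simp add: differential_add[OF X\<xi> lb p] 1)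
  \<comment> \<open>The screen condition \<omega>(x) = 0 is what lets the degenerate metric be
    exchanged for the rigged one.\<close>
  have "pullback_metric B A i g p (cov_deriv B \<Gamma>' \<xi> \<xi> p) x = ?h p (cov_deriv B \<Gamma>' \<xi> \<xi> p) x"
    by (simp add: rigged_metric_def rigging_form_def x\<omega>)
  also have "\<dots> = dir_deriv B p (\<xi> p) (\<lambda>q. ?h q (\<xi> q) (X q)) - ?\<omega> (lie_bracket B \<xi> X p)"
    using induced.metric_compatible[OF s\<xi> s\<xi> X pb] rigged_metric_\<xi>[OF p \<xi>X] by (simp add: 2 Xp)
  \<comment> \<open>The passage between the connections: this function is also g(\<zeta>,X) along
    \<open>i\<close>, so the ambient product rule applies to it.\<close>
  also have "dir_deriv B p (\<xi> p) (\<lambda>q. ?h q (\<xi> q) (X q)) =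
      g (i p) (d_along p (\<xi> p) (\<lambda>q. \<zeta> (i q))) (push p (X p)) +
      g (i p) (\<zeta> (i p)) (d_along p (\<xi> p) (\<lambda>q. push q (X q)))"
    by (rule dir_deriv_metric_along[OF b c \<xi> Z' X'])
      (use sub smooth_vector_field_on_tangent[OF X] in \<open>auto intro!: rigged_metric_\<xi>\<close>)
  also have "g (i p) (\<zeta> (i p)) (d_along p (\<xi> p) (\<lambda>q. push q (X q))) =
      g (i p) (\<zeta> (i p)) (d_along p x \<xi>_along) + ?\<omega> (lie_bracket B \<xi> X p)"
    unfolding torsion_free_along[OF b c s\<xi> X order_refl lb]
    using metric_add_right[OF c d_along_\<xi>_in_tangent_space[OF p xt] differential_in_tangent_space[OF lb p] \<zeta>]
    by (simp add: Xp)
  \<comment> \<open>By skewness both sides are - g(\<xi>,\<nabla>_x \<zeta>). The two surviving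
    terms thus coincide, which is the origin of the factor 2.\<close>
  also have "g (i p) (d_along p (\<xi> p) (\<lambda>q. \<zeta> (i q))) (push p (X p)) =
      g (i p) (\<zeta> (i p)) (d_along p x \<xi>_along)"
    using conformal_at_\<xi>[OF p xt] metric_d_along_rigging[OF p xt] by (simp add: Xp)
  finally show ?thesis by simp
qed

end

theorem lemma11:
  fixes A :: "('m::{t2_space, second_countable_topology}, 'e::euclidean_space) chart set"
    and g :: "('m, 'e) metric"
    and \<Gamma> :: "('m, 'e) christoffel"
    and B :: "('n::{t2_space, second_countable_topology}, 'l::euclidean_space) chart set"
    and i :: "'n \<Rightarrow> 'm"
    and U :: "'m set"
    and \<zeta> :: "'m \<Rightarrow> ('m, 'e) tvec"
    and \<xi> :: "'n \<Rightarrow> ('n, 'l) tvec"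
    and \<Gamma>' :: "('n, 'l) christoffel"
  assumes "smooth_atlas A"
    and "lorentzian_metric A g"
    and "time_orientable A g"
    and "levi_civita A g \<Gamma>"
    and "null_hypersurface B A i g"
    and "rigging B A i U \<zeta>"
    and "rigged_vector_field B A i g \<zeta> \<xi>"
    and "levi_civita B (rigged_metric B A i g \<zeta>) \<Gamma>'"
    and "conformal_field_on A g U \<zeta>"
  shows "(\<forall>p\<in>carrier_of B.
            ambient_deriv B A i \<Gamma> \<xi> p (\<xi> p) = (\<lambda>_. 0) \<and>
            rotation_form B A i g \<Gamma> \<zeta> \<xi> p (\<xi> p) = 0) \<and>
         (\<forall>p\<in>carrier_of B. \<forall>x\<in>screen B A i g \<zeta> p.
            rotation_form B A i g \<Gamma> \<zeta> \<xi> p x =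
              - (1/2) * pullback_metric B A i g p (cov_deriv B \<Gamma>' \<xi> \<xi> p) x)"
proof -
  interpret conformal_null_rigging A g \<Gamma> B i U \<zeta> \<xi> \<Gamma>'
    by unfold_locales (use assms in \<open>auto simp: lorentzian_metric_def null_hypersurface_def hypersurface_def\<close>)
  \<comment> \<open>The metric is linear on tangent vectors only, so its value at the zero family is
    obtained from additivity there.\<close>
  have zero: "g (i p) (\<zeta> (i p)) (\<lambda>_. 0) = 0" if p: "p \<in> carrier_of B" for p
  proof -
    obtain c where c: "c \<in> charts_at A (i p)" using carrier_charts[OF p] .
    show ?thesis
      using metric_add_right[OF c zero_in_tangent_space[OF c] zero_in_tangent_space[OF c]
          rigging_in_tangent_space[OF p]] by simp
  qed
  show ?thesis
  proof (intro conjI ballI)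
    fix p assume p: "p \<in> carrier_of B"
    show "ambient_deriv B A i \<Gamma> \<xi> p (\<xi> p) = (\<lambda>_. 0)"
      by (simp add: ambient_deriv_\<xi> d_along_\<xi>_\<xi>[OF p])
    show "rotation_form B A i g \<Gamma> \<zeta> \<xi> p (\<xi> p) = 0"
      by (simp add: rotation_form_eq[OF p rigged_in_tangent_space[OF p]] d_along_\<xi>_\<xi>[OF p] zero[OF p])
    fix x assume x: "x \<in> screen B A i g \<zeta> p"
    then have "x \<in> tangent_space B p" by (simp add: screen_def)
    then show "rotation_form B A i g \<Gamma> \<zeta> \<xi> p x =
        - (1/2) * pullback_metric B A i g p (cov_deriv B \<Gamma>' \<xi> \<xi> p) x"
      by (simp add: rotation_form_eq[OF p] pullback_induced_deriv[OF p x])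
  qed
qed

end
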